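(* Let $n\ge 1$ and let $P_1(z)=a_nz^n+a_{n-1}z^{n-1}+\cdots+a_0$ and $P_0(z)=b_nz^n+b_{n-1}z^{n-1}+\cdots+b_0$ be non-constant polynomials with complex coefficients, $a_n\neq 0$, $b_n\neq 0$. Let $h_1$ and $h_0$ be entire functions, not identically zero, satisfying $\rho(h_1)<\deg P_1$ and $\rho(h_0)<\deg P_0$. Suppose that $P_1(z)-cP_0(z)$ is a constant for some real $c\geq 1$, that $h_1$ has Fabry gaps, and that $\mu(h_0)>\rho(h_1)$. Then every non-constant solution $f$ of the differential equation $$f''+h_1(z)e^{P_1(z)}f'+h_0(z)e^{P_0(z)}f=0$$ has infinite order.
   Context: All solutions of this equation are entire functions. For an entire function $g$, with $M(r,g)=\max_{|z|=r}|g(z)|$, the order is $\rho(g)=\limsup_{r\to\infty}\frac{\log^+\log^+ M(r,g)}{\log r}$ and the lower order is $\mu(g)=\liminf_{r\to\infty}\frac{\log^+\log^+ M(r,g)}{\log r}$. An entire function $g(z)=\sum_{n=0}^\infty a_{\lambda_n}z^{\lambda_n}$ (with $\lambda_n$ increasing) is said to have Fabry gaps if $\lambda_n/n\to\infty$ as $n\to\infty$. *)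

theory Defs
  imports "HOL-Complex_Analysis.Complex_Analysis" "HOL-Computational_Algebra.Polynomial"
begin

definition logp :: "real \<Rightarrow> real" where
  "logp x = (if x \<le> 1 then 0 else ln x)"

definition max_mod :: "real \<Rightarrow> (complex \<Rightarrow> complex) \<Rightarrow> real" where
  "max_mod r g = Sup ((\<lambda>z. norm (g z)) ` sphere 0 r)"

definition ent_order :: "(complex \<Rightarrow> complex) \<Rightarrow> ereal" where
  "ent_order g = Limsup at_top (\<lambda>r::real. ereal (logp (logp (max_mod r g)) / ln r))"

definition ent_lower_order :: "(complex \<Rightarrow> complex) \<Rightarrow> ereal" where
  "ent_lower_order g = Liminf at_top (\<lambda>r::real. ereal (logp (logp (max_mod r g)) / ln r))"

definition fabry_gaps :: "(complex \<Rightarrow> complex) \<Rightarrow> bool" where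
  "fabry_gaps g \<longleftrightarrow> (\<exists>lam::nat \<Rightarrow> nat. strict_mono lam \<and>
     (\<forall>k. (deriv ^^ k) g 0 \<noteq> 0 \<longrightarrow> k \<in> range lam) \<and>
     filterlim (\<lambda>n. real (lam n) / real n) at_top sequentially)"

end

theory Submission
  imports Defs
begin

text \<open>
  Suppose that \<open>f\<close> has finite order. Away from small discs about the zeros of \<open>f\<close>, \<open>f'\<close> and \<open>h\<^sub>1\<close>, the
  logarithmic derivatives of \<open>f\<close> are polynomially bounded and \<open>h\<^sub>1\<close> is bounded below by
  \<open>exp (- r\<^sup>\<sigma>)\<close> with \<open>\<sigma> < n\<close>. By Borel--Cantelli a dense set of rays eventually avoids these discs.

  If \<open>c = 1\<close>, dividing the equation by \<open>exp (P\<^sub>0) f\<close> on such rays with \<open>Re P\<^sub>0 > 0\<close> bounds \<open>h\<^sub>0\<close> by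
  \<open>h\<^sub>1\<close> up to powers of \<open>r\<close>. These rays bound sectors of opening barely above \<open>\<pi> / n\<close>, and \<open>h\<^sub>0\<close> has order
  less than \<open>n\<close>, so Phragmen--Lindelof gives \<open>\<rho>(h\<^sub>0) \<le> \<rho>(h\<^sub>1)\<close>, a contradiction.

  If \<open>c > 1\<close>, then on rays with \<open>Re P\<^sub>0 > 0\<close> the term with \<open>f'\<close> dominates, so \<open>f' / f\<close> is
  exponentially small, while on rays with \<open>Re P\<^sub>0 < 0\<close> both coefficients are exponentially small; in
  either case \<open>f\<close> grows at most polynomially on the ray. Phragmen--Lindelof in thin sectors shows that
  \<open>f\<close> has order at most \<open>1/2\<close>. Then \<open>h\<^sub>1 f'\<close> has order less than \<open>n\<close> and decays like
  \<open>exp (- \<eta> r\<^sup>n)\<close> on a ray that avoids its zeros, which contradicts the lower bound for such functions.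
\<close>

section \<open>Estimates in a disc with the zeros divided out\<close>

text \<open>Discs of radius r^(-N) about the zeros are affordable: there are only polynomially many
  zeros up to radius r, and so small a disc costs the lower bounds no more than a factor log r in
  the exponent, which a slightly larger exponent absorbs. This is why strict gaps between exponents
  are opened throughout. The two uses of Phragmen-Lindelof meet different obstacles. For
  \<open>h0\<close> nothing is learned where Re P0 < 0, so a sector has to bridge a whole such gap,
  and only the distance between the order of \<open>h0\<close> and n makes this possible. For
  \<open>f\<close> the finite order may be huge, so the sectors must be far thinner than such a gap;
  here both signs of Re P0 have to give growth bounds, leaving out just the isolated directions
  where the leading part of Re P0 vanishes. The value 1/2 is a convenient order below n: in the
  final comparison \<open>h1\<close>, \<open>f'\<close> and \<open>f\<close> each account for at
  most exp(r^\<sigma>) with \<sigma> < n, against a decay of exp(-\<eta> r^n).\<close>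

lemma Borel_Caratheodory_half:
  fixes u :: "complex \<Rightarrow> complex"
  assumes hol: "u holomorphic_on ball z0 \<rho>" and "\<rho> > 0" and u0: "u z0 = 0"
    and re: "\<And>z. z \<in> ball z0 \<rho> \<Longrightarrow> Re (u z) < L"
    and z: "z \<in> cball z0 (\<rho>/2)"
  shows "norm (u z) \<le> 2 * L"
proof -
  have L: "L > 0" using re[of z0] u0 \<open>\<rho> > 0\<close> by simp
  define v where "v \<zeta> = u (z0 + of_real \<rho> * \<zeta>)" for \<zeta>
  \<comment> \<open>The Moebius map v / (2L - v) sends the half-plane Re v < L into the unit disc
    and fixes 0, so Schwarz's lemma applies.\<close>
  define w where "w \<zeta> = v \<zeta> / (2 * of_real L - v \<zeta>)" for \<zeta>
  have inb: "z0 + of_real \<rho> * \<zeta> \<in> ball z0 \<rho>" if "norm \<zeta> < 1" for \<zeta>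
    using that \<open>\<rho> > 0\<close> by (simp add: dist_norm norm_mult)
  have re': "Re (v \<zeta>) < L" if "norm \<zeta> < 1" for \<zeta>
    using re[OF inb[OF that]] by (simp add: v_def)
  have lt: "norm (v \<zeta>) < norm (2 * of_real L - v \<zeta>)" if "norm \<zeta> < 1" for \<zeta>
  proof -
    \<comment> \<open>The difference of the two squares is 4L(L - Re v).\<close>
    have "(norm (v \<zeta>))\<^sup>2 < (norm (2 * of_real L - v \<zeta>))\<^sup>2"
      using mult_strict_left_mono[OF re'[OF that], of "4 * L"] L
      unfolding cmod_power2 by (simp add: power2_eq_square algebra_simps)
    then show ?thesis by (rule power_less_imp_less_base) simp
  qed
  have nz: "2 * of_real L - v \<zeta> \<noteq> 0" if "norm \<zeta> < 1" for \<zeta>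
    using lt[OF that] by auto
  have vhol: "v holomorphic_on ball 0 1"
  proof -
    have "(u \<circ> (\<lambda>\<zeta>. z0 + of_real \<rho> * \<zeta>)) holomorphic_on ball 0 1"
      by (rule holomorphic_on_compose_gen[OF _ hol]) (auto intro!: holomorphic_intros simp del: mem_ball intro: inb simp: mem_ball_0)
    then show ?thesis unfolding v_def o_def .
  qed
  define \<zeta> where "\<zeta> = (z - z0) / of_real \<rho>"
  have n\<zeta>: "norm \<zeta> \<le> 1/2"
    using z \<open>\<rho> > 0\<close> by (simp add: \<zeta>_def norm_divide dist_norm norm_minus_commute field_simps)
  have "norm (w \<zeta>) \<le> norm \<zeta>"
  proof (rule Schwarz_Lemma(1)[of w])
    show "w holomorphic_on ball 0 1"
      unfolding w_def using vhol nz by (intro holomorphic_intros) auto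
    show "w 0 = 0" by (simp add: w_def v_def u0)
    show "norm (w x) < 1" if "norm x < 1" for x
      using lt[OF that] nz[OF that] by (simp add: w_def norm_divide divide_less_eq_1)
  qed (use n\<zeta> in simp)
  then have wh: "norm (w \<zeta>) \<le> 1/2" using n\<zeta> by simp
  have "v \<zeta> = w \<zeta> * (2 * of_real L - v \<zeta>)"
    using nz[of \<zeta>] n\<zeta> by (simp add: w_def)
  then have "norm (v \<zeta>) = norm (w \<zeta>) * norm (2 * of_real L - v \<zeta>)"
    by (metis norm_mult)
  also have "\<dots> \<le> 1/2 * (2 * L + norm (v \<zeta>))"
    using wh L norm_triangle_ineq4[of "2 * of_real L" "v \<zeta>"] by (intro mult_mono) auto
  finally have "norm (v \<zeta>) \<le> 2 * L" by simp
  then show ?thesis using \<open>\<rho> > 0\<close> by (simp add: v_def \<zeta>_def)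
qed

lemma entire_factor_zero:
  assumes "g holomorphic_on UNIV" "g a = 0"
  obtains g' where "g' holomorphic_on UNIV" "\<And>z. g z = (z - a) * g' z"
proof
  show "(\<lambda>z. if z = a then deriv g a else (g z - g a) / (z - a)) holomorphic_on UNIV"
    by (rule pole_lemma_open) (use assms in auto)
qed (use assms in auto)

lemma norm_prod_list_ge:
  fixes as :: "complex list"
  assumes "\<And>a. a \<in> set as \<Longrightarrow> d \<le> norm (z - a)" "d \<ge> 0"
  shows "d ^ length as \<le> norm (\<Prod>a\<leftarrow>as. z - a)"
  using assms by (induction as) (auto simp: norm_mult intro!: mult_mono)

lemma norm_prod_list_le:
  fixes as :: "complex list"
  assumes "\<And>a. a \<in> set as \<Longrightarrow> norm (z - a) \<le> d" "d \<ge> 0"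
  shows "norm (\<Prod>a\<leftarrow>as. z - a) \<le> d ^ length as"
  using assms by (induction as) (auto simp: norm_mult intro!: mult_mono)

text \<open>Jensen's inequality without integrals: a zero within R/4 of the centre contributes a
  factor at most R/4 at \<open>z0\<close> but at least 3R/4 on the circle of radius R. Every zero,
  with multiplicity, therefore costs a factor 3 in the ratio of the maximum to the value at
  \<open>z0\<close>.\<close>

lemma factored_bounds:
  fixes F g :: "complex \<Rightarrow> complex"
  assumes ghol: "g holomorphic_on UNIV" and fac: "\<And>z. F z = (\<Prod>a\<leftarrow>as. z - a) * g z"
    and as: "set as \<subseteq> cball z0 (R/4)" and R: "R > 0" and F0: "F z0 \<noteq> 0"
    and M: "\<forall>z\<in>sphere z0 R. norm (F z) \<le> M"
  shows "norm (F z0) * (4/R) ^ length as \<le> norm (g z0)"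
    and "z \<in> cball z0 R \<Longrightarrow> norm (g z) * 3 ^ length as \<le> norm (g z0) * (M / norm (F z0))"
    and "3 ^ length as \<le> M / norm (F z0)"
proof -
  let ?N = "length as"
  have a1: "norm (z0 - a) \<le> R/4" if "a \<in> set as" for a
    using that as by (auto simp: dist_norm)
  have a2: "norm (z - a) \<ge> 3*R/4" if "a \<in> set as" "z \<in> sphere z0 R" for a z
  proof -
    have "R = norm ((z - a) - (z0 - a))" using that by (simp add: dist_norm norm_minus_commute)
    also have "\<dots> \<le> norm (z - a) + norm (z0 - a)" by (rule norm_triangle_ineq4)
    finally show ?thesis using a1[OF that(1)] by simp
  qed
  have "norm (F z0) = norm (\<Prod>a\<leftarrow>as. z0 - a) * norm (g z0)" by (simp add: fac norm_mult)
  also have "\<dots> \<le> (R/4) ^ ?N * norm (g z0)"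
    by (intro mult_right_mono norm_prod_list_le) (use a1 R in auto)
  finally have "norm (F z0) * (4/R) ^ ?N \<le> (R/4) ^ ?N * norm (g z0) * (4/R) ^ ?N"
    using R by (intro mult_right_mono) auto
  also have "\<dots> = norm (g z0)" using R by (simp add: power_divide)
  finally show 1: "norm (F z0) * (4/R) ^ ?N \<le> norm (g z0)" .
  have sph: "norm (g z) \<le> M * (4/(3*R)) ^ ?N" if "z \<in> sphere z0 R" for z
  proof -
    have "(3*R/4) ^ ?N * norm (g z) \<le> norm (\<Prod>a\<leftarrow>as. z - a) * norm (g z)"
      by (intro mult_right_mono norm_prod_list_ge) (use a2 that R in auto)
    also have "\<dots> = norm (F z)" by (simp add: fac norm_mult)
    also have "\<dots> \<le> M" using M that by blast
    finally have "(3*R/4) ^ ?N * norm (g z) * (4/(3*R)) ^ ?N \<le> M * (4/(3*R)) ^ ?N"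
      using R by (intro mult_right_mono) auto
    then show ?thesis using R by (simp add: power_divide)
  qed
  have 2: "norm (g z) * 3 ^ ?N \<le> norm (g z0) * (M / norm (F z0))" if z: "z \<in> cball z0 R" for z
  proof -
    have "norm (g z) \<le> M * (4/(3*R)) ^ ?N"
    proof (rule maximum_modulus_frontier[of g "cball z0 R"])
      show "g holomorphic_on interior (cball z0 R)" using ghol by (rule holomorphic_on_subset) simp
      show "continuous_on (closure (cball z0 R)) g"
        using ghol holomorphic_on_imp_continuous_on continuous_on_subset by blast
    qed (use R sph z in auto)
    then have "norm (g z) * 3 ^ ?N \<le> M * (4/(3*R)) ^ ?N * 3 ^ ?N"
      by (intro mult_right_mono) auto
    also have "\<dots> = (norm (F z0) * (4/R) ^ ?N) * (M / norm (F z0))"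
      using F0 by (simp add: power_divide power_mult_distrib)
    also have "\<dots> \<le> norm (g z0) * (M / norm (F z0))"
    proof (rule mult_right_mono[OF 1])
      have "norm (F (z0 + of_real R)) \<le> M" using M R by (simp add: dist_norm)
      then have "0 \<le> M" by (rule order_trans[OF norm_ge_zero])
      then show "0 \<le> M / norm (F z0)" by simp
    qed
    finally show ?thesis .
  qed
  then show "z \<in> cball z0 R \<Longrightarrow> norm (g z) * 3 ^ length as \<le> norm (g z0) * (M / norm (F z0))" .
  have "norm (g z0) > 0" using F0 by (auto simp: fac)
  moreover have "norm (g z0) * 3 ^ ?N \<le> norm (g z0) * (M / norm (F z0))"
    by (rule 2) (use R in simp)
  ultimately show "3 ^ length as \<le> M / norm (F z0)"
    by (simp only: mult_le_cancel_left_pos)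
qed

lemma entire_factor_zeros_in_disc:
  fixes F :: "complex \<Rightarrow> complex"
  assumes F: "F holomorphic_on UNIV" and R: "R > 0" and F0: "F z0 \<noteq> 0"
    and M: "\<forall>z\<in>sphere z0 R. norm (F z) \<le> M"
  obtains as g where "g holomorphic_on UNIV" "\<And>z. F z = (\<Prod>a\<leftarrow>as. z - a) * g z"
    "set as \<subseteq> cball z0 (R/4)" "\<And>z. z \<in> cball z0 (R/4) \<Longrightarrow> g z \<noteq> 0"
proof -
  txt \<open>The number of factors in any factorisation is bounded, so one with the most factors exists.\<close>
  define Q where "Q N \<longleftrightarrow> (\<exists>as g. length as = N \<and> g holomorphic_on UNIV \<and> 
     (\<forall>z. F z = (\<Prod>a\<leftarrow>as. z - a) * g z) \<and> set as \<subseteq> cball z0 (R/4))" for N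
  have "Q 0" unfolding Q_def using F by auto
  obtain B :: nat where B: "M / norm (F z0) < 3 ^ B"
    using real_arch_pow[of 3 "M / norm (F z0)"] by auto
  have "N \<le> B" if "Q N" for N
  proof -
    obtain as g where *: "length as = N" "g holomorphic_on UNIV" 
     "\<And>z. F z = (\<Prod>a\<leftarrow>as. z - a) * g z" "set as \<subseteq> cball z0 (R/4)"
      using \<open>Q N\<close> unfolding Q_def by blast
    have "3 ^ N < (3::real) ^ B" using factored_bounds(3)[OF *(2-4) R F0 M] B unfolding *(1) by linarith
    then have "N < B" by (rule power_less_imp_less_exp[rotated]) simp
    then show ?thesis by simp
  qed
  then obtain N where N: "Q N" "\<And>N'. Q N' \<Longrightarrow> N' \<le> N"
    using Nat.ex_has_greatest_nat[of Q 0 B] \<open>Q 0\<close> by blast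
  obtain as g where *: "length as = N" "g holomorphic_on UNIV" 
     "\<And>z. F z = (\<Prod>a\<leftarrow>as. z - a) * g z" "set as \<subseteq> cball z0 (R/4)"
    using \<open>Q N\<close> unfolding Q_def by blast
  have "g z \<noteq> 0" if z: "z \<in> cball z0 (R/4)" for z
  proof
    assume "g z = 0"
    then obtain g' where "g' holomorphic_on UNIV" "\<And>w. g w = (w - z) * g' w"
      using entire_factor_zero[OF *(2)] by blast
    then have "Q (Suc N)" unfolding Q_def using * z
      by (intro exI[of _ "z # as"] exI[of _ g']) (auto simp: mult_ac)
    then show False using N(2) by force
  qed
  then show ?thesis using that * by blast
qed

text \<open>This is F'/F = sum 1/(z - a) + g'/g, multiplied out so that the induction over the
  factors never divides by \<open>g z\<close>.\<close>

lemma deriv_prod_list_bound: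
  fixes g :: "complex \<Rightarrow> complex"
  assumes "g holomorphic_on UNIV" "d > 0" "\<And>a. a \<in> set as \<Longrightarrow> d \<le> norm (z - a)"
    and "norm (deriv g z) \<le> B * norm (g z)"
  shows "norm (deriv (\<lambda>z. (\<Prod>a\<leftarrow>as. z - a) * g z) z)
           \<le> (real (length as) / d + B) * norm ((\<Prod>a\<leftarrow>as. z - a) * g z)"
  using assms(3)
proof (induction as)
  case Nil
  then show ?case using assms by simp
next
  case (Cons b as)
  define G where "G = (\<lambda>z. (\<Prod>a\<leftarrow>as. z - a) * g z)"
  have "(\<lambda>z. \<Prod>a\<leftarrow>as. z - a) holomorphic_on UNIV"
    by (induction as) (auto intro!: holomorphic_intros)
  then have "G holomorphic_on UNIV" unfolding G_def using assms(1) by (intro holomorphic_intros)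
  then have Gd: "(G has_field_derivative deriv G z) (at z)" by (simp add: holomorphic_derivI)
  have "((\<lambda>z. (z - b) * G z) has_field_derivative G z + (z - b) * deriv G z) (at z)"
    by (rule derivative_eq_intros Gd refl | simp)+
  then have eq: "deriv (\<lambda>z. (z - b) * G z) z = G z + (z - b) * deriv G z"
    by (rule DERIV_imp_deriv)
  have fe: "(\<lambda>z. (\<Prod>a\<leftarrow>b # as. z - a) * g z) = (\<lambda>z. (z - b) * G z)"
    by (auto simp: G_def mult_ac)
  have zb: "norm (z - b) \<ge> d" using Cons.prems by simp
  have IH: "norm (deriv G z) \<le> (real (length as) / d + B) * norm (G z)"
    using Cons unfolding G_def by simp
  have "norm (G z + (z - b) * deriv G z) \<le> norm (G z) + norm (z - b) * norm (deriv G z)"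
    by (metis norm_mult norm_triangle_ineq)
  also have "norm (G z) \<le> norm (z - b) / d * norm (G z)"
    using zb \<open>d > 0\<close> mult_right_mono[of 1 "norm (z - b) / d" "norm (G z)"] by simp
  also have "norm (z - b) / d * norm (G z) + norm (z - b) * norm (deriv G z)
       \<le> norm (z - b) / d * norm (G z) + norm (z - b) * ((real (length as) / d + B) * norm (G z))"
    using IH by (intro add_left_mono mult_left_mono) auto
  also have "\<dots> = (real (length (b # as)) / d + B) * norm ((z - b) * G z)"
    using \<open>d > 0\<close> unfolding norm_mult by (simp add: field_simps)
  finally have "norm (deriv (\<lambda>z. (z - b) * G z) z)
      \<le> (real (length (b # as)) / d + B) * norm ((z - b) * G z)" by (simp only: eq)
  then show ?case unfolding fe fun_cong[OF fe, of z] .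
qed

text \<open>The radii are nested: zeros are divided out up to R/4, where the quotient then has a
  logarithm; Borel-Caratheodory bounds this logarithm up to R/8; Cauchy's estimate on discs of
  radius R/16 bounds its derivative up to R/16. \<open>L\<close> plays the role of log(M / |F
  z0|).\<close>

lemma entire_disc_estimates:
  fixes F :: "complex \<Rightarrow> complex"
  assumes F: "F holomorphic_on UNIV" and R: "R > 0" and F0: "F z0 \<noteq> 0"
    and M: "\<forall>z\<in>sphere z0 R. norm (F z) \<le> exp L * norm (F z0)" and L: "L \<ge> 0"
  obtains N where "real N \<le> L"
    "finite {a \<in> cball z0 (R/4). F a = 0}" "card {a \<in> cball z0 (R/4). F a = 0} \<le> N"
    "\<And>z d. z \<in> cball z0 (R/16) \<Longrightarrow> 0 < d \<Longrightarrow> (\<And>a. F a = 0 \<Longrightarrow> d \<le> norm (z - a)) \<Longrightarrow>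
       norm (deriv F z) \<le> (L / d + 32 * (L + 1) / R) * norm (F z)"
    "\<And>z d. z \<in> cball z0 (R/16) \<Longrightarrow> 0 < d \<Longrightarrow> (\<And>a. F a = 0 \<Longrightarrow> d \<le> norm (z - a)) \<Longrightarrow>
       (4 * d / R) ^ N * exp (- 2 * (L + 1)) * norm (F z0) \<le> norm (F z)"
proof -
  obtain as g where g: "g holomorphic_on UNIV" and fac: "\<And>z. F z = (\<Prod>a\<leftarrow>as. z - a) * g z"
    and as: "set as \<subseteq> cball z0 (R/4)" and gnz: "\<And>z. z \<in> cball z0 (R/4) \<Longrightarrow> g z \<noteq> 0"
    by (rule entire_factor_zeros_in_disc[OF F R F0 M]) (rule that)
  let ?N = "length as"
  note fb = factored_bounds[OF g fac as R F0 M]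
  have zer: "F a = 0" if "a \<in> set as" for a
  proof -
    have "(\<Prod>a'\<leftarrow>as. a - a') = 0" using that by (induction as) auto
    then show ?thesis by (simp add: fac)
  qed
  have zsub: "{a \<in> cball z0 (R/4). F a = 0} = set as"
  proof -
    have "a \<in> set as" if "a \<in> cball z0 (R/4)" "F a = 0" for a
    proof -
      have "0 \<in> set (map (\<lambda>a'. a - a') as)"
        using that gnz[OF that(1)] by (auto simp: fac prod_list_zero_iff)
      then show ?thesis by auto
    qed
    then show ?thesis using zer as by auto
  qed
  \<comment> \<open>A factor 3 per zero, compared with e <= 3, turns the Jensen bound into N <=
    L.\<close>
  have NL: "real ?N \<le> L"
  proof -
    have "exp (real ?N) \<le> 3 ^ ?N"
      using exp_le by (simp add: exp_of_nat_mult[of ?N 1, simplified] power_mono)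
    also have "\<dots> \<le> exp L" using fb(3) F0 by simp
    finally show ?thesis by simp
  qed
  have g0: "g z0 \<noteq> 0" using gnz R by simp
  obtain u0 where u0: "u0 holomorphic_on ball z0 (R/4)" "\<And>z. z \<in> ball z0 (R/4) \<Longrightarrow> exp (u0 z) = g z"
    by (rule holomorphic_logarithm_exists[of "ball z0 (R/4)" g z0])
       (use g gnz R in \<open>auto intro: holomorphic_on_subset\<close>)
  \<comment> \<open>The branch of log(g / g(z0)) that vanishes at the centre, as Borel-Caratheodory
    requires.\<close>
  define u where "u z = u0 z - u0 z0" for z
  have gu: "g z = g z0 * exp (u z)" if "z \<in> ball z0 (R/4)" for z
    using u0(2)[OF that] u0(2)[of z0] R g0 by (simp add: u_def exp_diff)
  have uhol: "u holomorphic_on ball z0 (R/4)" unfolding u_def by (intro holomorphic_intros u0)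
  \<comment> \<open>Passing from L to L + 1 supplies the strict inequality in
    Borel-Caratheodory.\<close>
  have ure: "Re (u z) < L + 1" if "z \<in> ball z0 (R/4)" for z
  proof -
    have "norm (g z) * 1 \<le> norm (g z) * 3 ^ ?N" by (intro mult_left_mono) auto
    also have "\<dots> \<le> norm (g z0) * (exp L * norm (F z0) / norm (F z0))"
      by (rule fb(2)) (use that R in auto)
    also have "\<dots> = norm (g z0) * exp L" using F0 by simp
    finally have "exp (Re (u z)) \<le> exp L"
      using gu[OF that] g0 by (simp add: norm_mult)
    then show ?thesis by simp
  qed
  have ub: "norm (u z) \<le> 2 * (L + 1)" if "z \<in> cball z0 (R/8)" for z
    by (rule Borel_Caratheodory_half[OF uhol]) (use that R ure in \<open>auto simp: u_def\<close>)
  have du: "norm (deriv u z) \<le> 32 * (L + 1) / R" if z: "z \<in> cball z0 (R/16)" for z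
  proof -
    have sub: "cball z (R/16) \<subseteq> cball z0 (R/8)"
    proof
      fix x assume "x \<in> cball z (R/16)"
      then show "x \<in> cball z0 (R/8)" using z dist_triangle[of z0 x z] by simp
    qed
    have sub2: "cball z (R/16) \<subseteq> ball z0 (R/4)"
      using sub R by fastforce
    have "norm ((deriv ^^ 1) u z) \<le> fact 1 * (2 * (L + 1)) / (R/16) ^ 1"
    proof (rule Cauchy_inequality)
      show "u holomorphic_on ball z (R/16)" 
        by (rule holomorphic_on_subset[OF uhol]) (use sub2 in auto)
      show "continuous_on (cball z (R/16)) u"
        by (rule continuous_on_subset[OF holomorphic_on_imp_continuous_on[OF uhol] sub2])
      show "norm (u x) \<le> 2 * (L + 1)" if "norm (z - x) = R/16" for x
        by (rule ub) (use that sub in \<open>auto simp: dist_norm\<close>)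
    qed (use R in auto)
    then show ?thesis by simp
  qed
  have dg: "norm (deriv g z) \<le> 32 * (L + 1) / R * norm (g z)" if z: "z \<in> cball z0 (R/16)" for z
  proof -
    have zb: "z \<in> ball z0 (R/4)" using z R by auto
    have "(u has_field_derivative deriv u z) (at z)"
      using uhol zb by (simp add: holomorphic_derivI)
    then have "((\<lambda>z. g z0 * exp (u z)) has_field_derivative g z0 * (exp (u z) * deriv u z)) (at z)"
      by (auto intro!: derivative_eq_intros)
    then have "(g has_field_derivative g z0 * (exp (u z) * deriv u z)) (at z)"
      by (rule has_field_derivative_transform_within_open[OF _ open_ball zb]) (simp add: gu)
    then have "deriv g z = g z * deriv u z"
      using gu[OF zb] by (simp add: DERIV_imp_deriv)
    then show ?thesis using mult_right_mono[OF du[OF z], of "norm (g z)"] by (simp add: norm_mult mult_ac)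
  qed
  show ?thesis
  proof (rule that[of ?N])
    show "real ?N \<le> L" by (rule NL)
    show "finite {a \<in> cball z0 (R/4). F a = 0}" "card {a \<in> cball z0 (R/4). F a = 0} \<le> ?N"
      unfolding zsub by (simp_all add: card_length)
    fix z d assume z: "z \<in> cball z0 (R/16)" and d: "0 < d" and ds: "\<And>a. F a = 0 \<Longrightarrow> d \<le> norm (z - a)"
    have Fe: "F = (\<lambda>z. (\<Prod>a\<leftarrow>as. z - a) * g z)" using fac by auto
    have "norm (deriv F z) \<le> (real ?N / d + 32 * (L + 1) / R) * norm (F z)"
      unfolding Fe by (rule deriv_prod_list_bound) (use g d ds zer dg z in auto)
    also have "\<dots> \<le> (L / d + 32 * (L + 1) / R) * norm (F z)"
      using NL d by (intro mult_right_mono add_right_mono divide_right_mono) auto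
    finally show "norm (deriv F z) \<le> (L / d + 32 * (L + 1) / R) * norm (F z)" .
    have zb: "z \<in> ball z0 (R/4)" using z R by auto
    have "- 2 * (L + 1) \<le> Re (u z)"
      using ub[of z] z R abs_Re_le_cmod[of "u z"] by auto
    then have "norm (g z0) * exp (- 2 * (L + 1)) \<le> norm (g z)"
      using gu[OF zb] by (simp add: norm_mult mult_left_mono)
    moreover have "norm (F z0) * (4/R) ^ ?N * exp (- 2 * (L + 1)) \<le> norm (g z0) * exp (- 2 * (L + 1))"
      by (intro mult_right_mono fb(1)) auto
    ultimately have "norm (F z0) * (4/R) ^ ?N * exp (- 2 * (L + 1)) \<le> norm (g z)" by linarith
    then have "d ^ ?N * (norm (F z0) * (4/R) ^ ?N * exp (- 2 * (L + 1))) \<le> norm (\<Prod>a\<leftarrow>as. z - a) * norm (g z)"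
      using R d by (intro mult_mono norm_prod_list_ge) (auto intro: ds zer)
    then show "(4 * d / R) ^ ?N * exp (- 2 * (L + 1)) * norm (F z0) \<le> norm (F z)"
      by (simp add: fac norm_mult power_divide power_mult_distrib mult_ac)
  qed
qed

section \<open>Rays avoiding the zeros\<close>

text \<open>The summand 1 absorbs the values on compact sets, so the bound holds at every point and
  no threshold radius has to be carried along.\<close>

definition exp_growth :: "real \<Rightarrow> (complex \<Rightarrow> complex) \<Rightarrow> bool" where
  "exp_growth s F \<longleftrightarrow> (\<exists>K\<ge>0. \<forall>z. norm (F z) \<le> exp (K * (1 + norm z powr s)))"

lemma estimates_away_from_zeros:
  fixes F :: "complex \<Rightarrow> complex"
  assumes F: "F holomorphic_on UNIV" and nz: "\<exists>z. F z \<noteq> 0" and s: "s > 0" and gr: "exp_growth s F"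
  obtains C T where "C > 0" "T \<ge> 1"
    "\<forall>r\<ge>T. finite {a \<in> cball 0 r. F a = 0} \<and> real (card {a \<in> cball 0 r. F a = 0}) \<le> C * r powr s"
    "\<forall>z d. norm z \<ge> T \<and> 0 < d \<and> d \<le> 1 \<and> (\<forall>a. F a = 0 \<longrightarrow> d \<le> norm (z - a)) \<longrightarrow>
       norm (deriv F z) \<le> C * norm z powr s / d * norm (F z) \<and>
       exp (- C * norm z powr s * (1 + ln (norm z) - ln d)) \<le> norm (F z)"
proof -
  obtain z0 where z0: "F z0 \<noteq> 0" using nz by blast
  obtain K where K: "K \<ge> 0" "\<And>z. norm (F z) \<le> exp (K * (1 + norm z powr s))"
    using gr unfolding exp_growth_def by blast
  define D where "D = \<bar>ln (norm (F z0))\<bar>"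
  define C1 where "C1 = K * (1 + 33 powr s) + D"
  have C1: "C1 \<ge> D" "D \<ge> 0" "C1 \<ge> 0" using K by (auto simp: C1_def D_def)
  \<comment> \<open>The 6 collects the multiples of \<open>C1\<close> in the lower bound: three from
    ln 8 <= 3, two from exp(-2(L + 1)), one from \<open>D\<close>. The 2 comes from the added 1 in L
    + 1.\<close>
  define C where "C = 6 * C1 + 2"
  define T where "T = max 1 (norm z0)"
  define L where "L r = K * (1 + (33 * r) powr s) + D" for r
  have rs1: "r powr s \<ge> 1" if "r \<ge> T" for r
    using that s by (simp add: T_def ge_one_powr_ge_zero)
  have L0: "L r \<ge> 0" for r using K by (simp add: L_def D_def)
  have L1: "L r \<le> C1 * r powr s" if "r \<ge> T" for r
  proof -
    have r1: "r powr s \<ge> 1" using rs1 that by simp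
    have "L r = K * (1 + 33 powr s * r powr s) + D"
      using that by (simp add: L_def powr_mult T_def)
    also have "\<dots> \<le> K * (r powr s + 33 powr s * r powr s) + D * r powr s"
      using r1 K(1) C1 mult_left_mono[of 1 "r powr s" D] by (intro add_mono mult_left_mono) auto
    also have "\<dots> = C1 * r powr s" by (simp add: C1_def algebra_simps)
    finally show ?thesis .
  qed
  have ed: "exp (- D) \<le> norm (F z0)"
  proof -
    have "exp (- D) \<le> exp (ln (norm (F z0)))" by (simp add: D_def)
    then show ?thesis using z0 by simp
  qed
  \<comment> \<open>Radius R = 32 r about \<open>z0\<close> makes R/16 = 2 r, which covers every z
    with |z| = r >= |z0|; the circle itself lies in |w| <= 33 r.\<close>
  have M: "\<forall>w\<in>sphere z0 (32 * r). norm (F w) \<le> exp (L r) * norm (F z0)" if "r \<ge> T" for r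
  proof
    fix w assume "w \<in> sphere z0 (32 * r)"
    then have "norm w \<le> 33 * r"
      using that norm_triangle_ineq[of z0 "w - z0"] by (auto simp: dist_norm norm_minus_commute T_def)
    then have "norm w powr s \<le> (33 * r) powr s" using s by (intro powr_mono2) auto
    then have "norm (F w) \<le> exp (K * (1 + (33 * r) powr s))"
      using K by (intro order_trans[OF K(2)[of w]]) (auto intro!: mult_left_mono)
    also have "\<dots> = exp (L r) * exp (- D)" by (simp add: L_def exp_add[symmetric])
    also have "\<dots> \<le> exp (L r) * norm (F z0)" using ed by simp
    finally show "norm (F w) \<le> exp (L r) * norm (F z0)" .
  qed
  show ?thesis
  proof (rule that[of C T]; (intro allI impI)?; (elim conjE)?)
    show "C > 0" "T \<ge> 1" using C1 by (auto simp: C_def T_def)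
  next
    fix r :: real assume r: "r \<ge> T"
    have r0: "32 * r > 0" using r by (simp add: T_def)
    obtain N where N: "real N \<le> L r" "finite {a \<in> cball z0 (32 * r/4). F a = 0}"
        "card {a \<in> cball z0 (32 * r/4). F a = 0} \<le> N"
      by (rule entire_disc_estimates[OF F r0 z0 M[OF r] L0])
    have "cball 0 r \<subseteq> cball z0 (32 * r/4)"
    proof
      fix x :: complex assume "x \<in> cball 0 r"
      then show "x \<in> cball z0 (32 * r/4)"
        using r norm_triangle_ineq4[of z0 x] by (auto simp: dist_norm T_def)
    qed
    then have sub: "{a \<in> cball 0 r. F a = 0} \<subseteq> {a \<in> cball z0 (32 * r/4). F a = 0}" by auto
    have "real (card {a \<in> cball 0 r. F a = 0}) \<le> real N"
      using card_mono[OF N(2) sub] N(3) by simp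
    also have "\<dots> \<le> C1 * r powr s" using N(1) L1[OF r] by simp
    also have "\<dots> \<le> C * r powr s" using C1 by (intro mult_right_mono) (auto simp: C_def)
    finally show "finite {a \<in> cball 0 r. F a = 0} \<and> real (card {a \<in> cball 0 r. F a = 0}) \<le> C * r powr s"
      using finite_subset[OF sub N(2)] by blast
  next
    fix z :: complex and d :: real
    assume zT: "norm z \<ge> T" and d: "0 < d" "d \<le> 1" and "\<forall>a. F a = 0 \<longrightarrow> d \<le> norm (z - a)"
    then have ds: "\<And>a. F a = 0 \<Longrightarrow> d \<le> norm (z - a)" by blast
    define r where "r = norm z"
    have r: "r \<ge> T" using zT by (simp add: r_def)
    have r1: "r \<ge> 1" using r by (simp add: T_def)
    have r0: "32 * r > 0" using r by (simp add: T_def)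
    obtain N where N: "real N \<le> L r"
      "norm (deriv F z) \<le> (L r / d + 32 * (L r + 1) / (32 * r)) * norm (F z)"
      "(4 * d / (32 * r)) ^ N * exp (- 2 * (L r + 1)) * norm (F z0) \<le> norm (F z)"
    proof (rule entire_disc_estimates[OF F r0 z0 M[OF r] L0])
      have zin: "z \<in> cball z0 (32 * r / 16)"
        using r norm_triangle_ineq4[of z0 z] by (auto simp: dist_norm T_def r_def)
      fix N assume "real N \<le> L r"
        "\<And>z d. z \<in> cball z0 (32 * r/16) \<Longrightarrow> 0 < d \<Longrightarrow> (\<And>a. F a = 0 \<Longrightarrow> d \<le> norm (z - a)) \<Longrightarrow>
       norm (deriv F z) \<le> (L r / d + 32 * (L r + 1) / (32 * r)) * norm (F z)"
        "\<And>z d. z \<in> cball z0 (32 * r/16) \<Longrightarrow> 0 < d \<Longrightarrow> (\<And>a. F a = 0 \<Longrightarrow> d \<le> norm (z - a)) \<Longrightarrow>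
       (4 * d / (32 * r)) ^ N * exp (- 2 * (L r + 1)) * norm (F z0) \<le> norm (F z)"
      with that[of N] zin d(1) ds show ?thesis by blast
    qed
    define q where "q = r powr s"
    have q: "q \<ge> 1" "L r \<le> C1 * q" using rs1 L1 r by (auto simp: q_def)
    have "L r / d + 32 * (L r + 1) / (32 * r) \<le> C * q / d"
    proof -
      have "(L r + 1) / r \<le> (L r + 1) / d" using d r1 L0[of r] by (intro divide_left_mono) auto
      then have "L r / d + 32 * (L r + 1) / (32 * r) \<le> (2 * L r + 1) / d"
        by (simp add: add_divide_distrib)
      also have "\<dots> \<le> C * q / d"
      proof (rule divide_right_mono)
        have "2 * L r + 1 \<le> 2 * (C1 * q) + q" using q by simp
        also have "\<dots> \<le> C * q" using C1 q by (simp add: C_def algebra_simps)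
        finally show "2 * L r + 1 \<le> C * q" .
      qed (use d in simp)
      finally show ?thesis .
    qed
    then have A: "norm (deriv F z) \<le> C * q / d * norm (F z)"
      using N(2) mult_right_mono[of _ _ "norm (F z)"] by (meson norm_ge_zero order_trans)
    define x where "x = ln r - ln d"
    have x: "x \<ge> 0" using d r1 by (simp add: x_def)
    have "ln (8::real) \<le> 3"
    proof -
      have "ln (8::real) = 3 * ln 2" using ln_realpow[of "2::real" 3] by simp
      also have "\<dots> \<le> 3" using ln2_le_25_over_36 by simp
      finally show ?thesis .
    qed
    then have "exp (- (3 + x)) \<le> exp (- (ln 8 + x))" by simp
    also have "exp (- (ln 8 + x)) = d / (8 * r)"
      using d r1 by (simp add: x_def exp_add exp_diff exp_minus field_simps)
    finally have b: "exp (- (3 + x)) \<le> 4 * d / (32 * r)" by simp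
    have "exp (- C * q * (1 + x)) \<le> exp (- (real N * (3 + x)) + (- 2 * (L r + 1)) + (- D))"
    proof -
      have "real N * (3 + x) \<le> C1 * q * (3 + x)" using N(1) q x by (intro mult_right_mono) auto
      moreover have "D \<le> C1 * q" using C1 q mult_mono[of D C1 1 q] by simp
      ultimately have "real N * (3 + x) + 2 * (L r + 1) + D \<le> C1 * q * (3 + x) + 2 * (C1 * q + q) + C1 * q"
        using q by (intro add_mono) auto
      also have "\<dots> \<le> C * q * (1 + x)"
      proof -
        have "C * q * (1 + x) - (C1 * q * (3 + x) + 2 * (C1 * q + q) + C1 * q) = 5 * C1 * (q * x) + 2 * (q * x)"
          by (simp add: C_def algebra_simps)
        moreover have "\<dots> \<ge> 0" using C1 q x by simp
        ultimately show ?thesis by linarith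
      qed
      finally show ?thesis by simp
    qed
    also have "\<dots> = exp (- (3 + x)) ^ N * exp (- 2 * (L r + 1)) * exp (- D)"
      unfolding exp_add by (simp add: exp_of_nat_mult[symmetric] algebra_simps)
    also have "\<dots> \<le> (4 * d / (32 * r)) ^ N * exp (- 2 * (L r + 1)) * norm (F z0)"
      using ed b d r1 by (intro mult_mono power_mono) auto
    also have "\<dots> \<le> norm (F z)" by (rule N(3))
    finally have B: "exp (- C * q * (1 + x)) \<le> norm (F z)" .
    show "norm (deriv F z) \<le> C * norm z powr s / d * norm (F z) \<and>
       exp (- C * norm z powr s * (1 + ln (norm z) - ln d)) \<le> norm (F z)"
      using A B by (simp add: q_def x_def r_def add_diff_eq)
  qed
qed

lemma ex_interval_AE:
  assumes "AE x in lborel. P x" and "a < (b::real)"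
  obtains x where "a < x" "x < b" "P x"
proof -
  obtain N where N: "{x. \<not> P x} \<subseteq> N" "N \<in> null_sets lborel"
    using assms(1) unfolding eventually_ae_filter by auto
  have "\<not> {a<..<b} \<subseteq> N"
  proof
    assume "{a<..<b} \<subseteq> N"
    then have "{a<..<b} \<in> null_sets lborel" using N(2) by (rule null_sets_subset[rotated 2]) auto
    then show False using assms(2) by (simp add: null_sets_def)
  qed
  then show ?thesis using N(1) that by (metis (mono_tags, lifting) greaterThanLessThan_iff mem_Collect_eq subsetD subsetI)
qed

text \<open>Slopes replace angles: a point close to the ray through (1, s) has a slope whose
  distance from \<open>s\<close> is linear in \<open>d\<close>, so each zero forbids an explicit
  interval of slopes. The condition \<open>1 + d \<le> \<tau>\<close> keeps Re b >= 1, so the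
  division is harmless.\<close>

lemma close_to_ray_slope:
  fixes b :: complex and \<tau> s d :: real
  assumes "norm (of_real \<tau> * Complex 1 s - b) < d" "\<bar>s\<bar> \<le> 1" "1 + d \<le> \<tau>"
  shows "\<bar>s - Im b / Re b\<bar> \<le> 2 * d"
proof -
  have 1: "\<bar>\<tau> - Re b\<bar> < d"
    using abs_Re_le_cmod[of "of_real \<tau> * Complex 1 s - b"] assms(1) by simp
  have 2: "\<bar>\<tau> * s - Im b\<bar> < d"
    using abs_Im_le_cmod[of "of_real \<tau> * Complex 1 s - b"] assms(1) by simp
  have R: "Re b \<ge> 1" using 1 assms(3) by linarith
  have "\<bar>(\<tau> - Re b) * s\<bar> \<le> d * 1"
    unfolding abs_mult using 1 assms(2) by (intro mult_mono) auto
  then have "\<bar>Re b * s - Im b\<bar> \<le> 2 * d" using 2 by (simp add: algebra_simps abs_le_iff) linarith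
  then have "\<bar>Re b * s - Im b\<bar> / Re b \<le> 2 * d / 1"
    using R by (intro frac_le) auto
  moreover have "\<bar>s - Im b / Re b\<bar> = \<bar>Re b * s - Im b\<bar> / Re b"
    proof -
    have "s - Im b / Re b = (Re b * s - Im b) / Re b" using R by (simp add: field_simps)
    then show ?thesis using R by (simp add: abs_divide)
  qed
  ultimately show ?thesis by simp
qed

lemma ray_avoiding_set:
  fixes Z :: "complex set" and N :: nat
  assumes cnt: "\<And>r. r \<ge> T \<Longrightarrow> finite (Z \<inter> cball 0 r) \<and> real (card (Z \<inter> cball 0 r)) \<le> C * r ^ N"
    and xy: "x < (y::real)"
  obtains \<theta> where "x < \<theta>" "\<theta> < y"
    "eventually (\<lambda>t. \<forall>a\<in>Z. 1 / t ^ (N+2) \<le> norm (of_real t * cis \<theta> - a)) at_top"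
proof -
  define T' where "T' = nat \<lceil>max T 1\<rceil>"
  have T': "real T' \<ge> T" "T' \<ge> 1" unfolding T'_def by linarith+
  txt \<open>Borel--Cantelli for the slope \<open>s\<close> of the ray relative to direction \<open>x\<close>: a ray that comes too
    close to \<open>a\<close> at distance between \<open>m\<close> and \<open>m + 1\<close> has its slope in a short interval about \<open>sl a\<close>.\<close>
  define sl where "sl a = Im (a * cis (-x)) / Re (a * cis (-x))" for a
  define A where "A m = (if m \<ge> T' then \<Union>a\<in>Z \<inter> cball 0 (real m + 2).
       {sl a - 2 / real m ^ (N+2) .. sl a + 2 / real m ^ (N+2)} else {})" for m
  \<comment> \<open>O(m^N) zeros each forbid an interval of length 4 / m^(N+2); the two extra powers
    leave 1/m^2, which is summable.\<close>
  have meas: "A m \<in> sets lborel \<and> emeasure lborel (A m) \<le> ennreal (4 * \<bar>C\<bar> * 3 ^ N * (1 / real m ^ 2))" for m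
  proof (cases "m \<ge> T'")
    case True
    let ?Y = "Z \<inter> cball 0 (real m + 2)"
    have m: "real m \<ge> 1" "real m \<ge> T" using True T' by linarith+
    have fin: "finite ?Y" and card: "real (card ?Y) \<le> C * (real m + 2) ^ N"
      using cnt[of "real m + 2"] m by auto
    have "emeasure lborel (A m) \<le> (\<Sum>a\<in>?Y. emeasure lborel {sl a - 2 / real m ^ (N+2) .. sl a + 2 / real m ^ (N+2)})"
      using True unfolding A_def if_P[OF True] by (intro emeasure_subadditive_finite fin) auto
    also have "\<dots> = (\<Sum>a\<in>?Y. ennreal (4 / real m ^ (N+2)))"
      using m by (intro sum.cong refl) (simp add: emeasure_lborel_Icc)
    also have "\<dots> = ennreal (real (card ?Y) * (4 / real m ^ (N+2)))"
      by (simp only: sum_constant ennreal_of_nat_eq_real_of_nat) (simp add: ennreal_mult del: times_divide_eq_right power_Suc power_add add_2_eq_Suc')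
    also have "\<dots> \<le> ennreal (4 * \<bar>C\<bar> * 3 ^ N * (1 / real m ^ 2))"
    proof (rule ennreal_leI)
      have "real (card ?Y) \<le> \<bar>C\<bar> * (3 * real m) ^ N"
        using m by (intro order_trans[OF card] mult_mono power_mono) auto
      then have "real (card ?Y) * (4 / real m ^ (N+2)) \<le> \<bar>C\<bar> * (3 * real m) ^ N * (4 / real m ^ (N+2))"
        by (intro mult_right_mono) auto
      also have "\<dots> = 4 * \<bar>C\<bar> * 3 ^ N * (1 / real m ^ 2)"
        using m by (simp add: power_add power_mult_distrib power2_eq_square)
      finally show "real (card ?Y) * (4 / real m ^ (N+2)) \<le> 4 * \<bar>C\<bar> * 3 ^ N * (1 / real m ^ 2)" .
    qed
    finally show ?thesis using True fin by (auto simp: A_def)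
  qed (auto simp: A_def)
  have "AE s in lborel. eventually (\<lambda>m. s \<in> space lborel - A m) sequentially"
  proof (rule borel_cantelli_AE1)
    show "A m \<in> sets lborel" for m using meas by blast
    show "emeasure lborel (A m) < \<infinity>" for m
      using meas[of m] by (auto intro: le_less_trans)
    show "summable (\<lambda>m. measure lborel (A m))"
    proof (rule summable_comparison_test')
      show "summable (\<lambda>m. 4 * \<bar>C\<bar> * 3 ^ N * (1 / real m ^ 2))"
        by (intro summable_mult) (use inverse_power_summable[of 2, where 'a = real] in \<open>simp add: field_simps\<close>)
      show "norm (measure lborel (A m)) \<le> 4 * \<bar>C\<bar> * 3 ^ N * (1 / real m ^ 2)" for m
        using meas[of m] by (simp add: measure_def enn2real_leI)
    qed
  qed
  moreover have "0 < min 1 (y - x)" using xy by simp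
  ultimately obtain s where s: "0 < s" "s < min 1 (y - x)" and ev: "eventually (\<lambda>m. s \<notin> A m) sequentially"
    by (rule ex_interval_AE) auto
  obtain m0 where m0: "\<And>m. m \<ge> m0 \<Longrightarrow> s \<notin> A m" using ev unfolding eventually_sequentially by blast
  define \<theta> where "\<theta> = x + arctan s"
  show ?thesis
  proof (rule that[of \<theta>])
    show "x < \<theta>" using s by (simp add: \<theta>_def)
    show "\<theta> < y" using s arctan_le_self[of s] by (simp add: \<theta>_def)
    have "1 / t ^ (N+2) \<le> norm (of_real t * cis \<theta> - a)" if t: "t \<ge> max 4 (max (real T' + 1) (real m0 + 1))" and a: "a \<in> Z" for t a
    proof (rule ccontr)
      assume "\<not> ?thesis"
      then have lt: "norm (of_real t * cis \<theta> - a) < 1 / t ^ (N+2)" by simp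
      \<comment> \<open>The bound |a| < t + 1 < m + 2 explains the disc in \<open>A m\<close>, and m
        <= t makes the tolerance 2 / t^(N+2) at most the one in \<open>A m\<close>.\<close>
      define m where "m = nat \<lfloor>t\<rfloor>"
      have m: "real m \<le> t" "t < real m + 1" "m \<ge> m0" "m \<ge> T'" "m \<ge> 1"
        unfolding m_def using t by linarith+
      \<comment> \<open>The abscissa t cos(arctan s) of the point at distance t, in coordinates
        rotated by \<open>x\<close>.\<close>
      define \<tau> where "\<tau> = t / sqrt (1 + s\<^sup>2)"
      have sq: "sqrt (1 + s\<^sup>2) \<le> 2" 
      proof (rule real_le_lsqrt)
        show "1 + s\<^sup>2 \<le> 2\<^sup>2" using s power_le_one[of s 2] by simp
      qed auto
      have sq0: "sqrt (1 + s\<^sup>2) > 0" by (simp add: add_pos_nonneg)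
      have \<tau>: "\<tau> \<ge> 2"
      proof -
        have "t / 2 \<le> \<tau>" unfolding \<tau>_def using sq sq0 t by (intro divide_left_mono) auto
        then show ?thesis using t by simp
      qed
      have d1: "1 / t ^ (N+2) \<le> 1" using t one_le_power[of t "N+2"] by (simp del: power_Suc power_add add_2_eq_Suc')
      define b where "b = a * cis (-x)"
      have cs: "of_real t * cis (arctan s) = of_real \<tau> * Complex 1 s"
        by (simp add: complex_eq_iff cos_arctan sin_arctan \<tau>_def)
      have "of_real t * cis \<theta> - a = (of_real t * cis (arctan s) - b) * cis x"
        by (simp add: \<theta>_def b_def algebra_simps cis_mult)
      then have "norm (of_real \<tau> * Complex 1 s - b) < 1 / t ^ (N+2)"
        using lt by (simp add: norm_mult cs)
      then have "\<bar>s - Im b / Re b\<bar> \<le> 2 * (1 / t ^ (N+2))"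
        by (rule close_to_ray_slope) (use s \<tau> d1 in auto)
      also have "\<dots> \<le> 2 / real m ^ (N+2)"
      proof -
        have "real m ^ (N+2) \<le> t ^ (N+2)" "0 < real m ^ (N+2)"
          using m by (intro power_mono zero_less_power; simp)+
        then show ?thesis using frac_le[of 2 2 "real m ^ (N+2)" "t ^ (N+2)"] by simp
      qed
      finally have sl: "\<bar>s - sl a\<bar> \<le> 2 / real m ^ (N+2)" by (simp add: sl_def b_def)
      have "norm a \<le> norm (of_real t * cis \<theta>) + norm (of_real t * cis \<theta> - a)"
        by (metis norm_minus_commute norm_triangle_sub)
      also have "\<dots> \<le> real m + 2" using less_le_trans[OF lt d1] m(2) t by (simp add: norm_mult)
      finally have "a \<in> Z \<inter> cball 0 (real m + 2)" using a by simp
      then have "s \<in> A m" using sl m unfolding A_def by (auto simp: abs_le_iff intro!: bexI[of _ a])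
      then show False using m0 m by blast
    qed
    then show "eventually (\<lambda>t. \<forall>a\<in>Z. 1 / t ^ (N+2) \<le> norm (of_real t * cis \<theta> - a)) at_top"
      unfolding eventually_at_top_linorder by blast
  qed
qed

section \<open>The Phragmen--Lindelof principle\<close>

text \<open>All t > 0 are included because z = exp w turns the ray into a full line, whose left end
  corresponds to t near 0.\<close>

definition ray_growth :: "real \<Rightarrow> (complex \<Rightarrow> complex) \<Rightarrow> real \<Rightarrow> bool" where
  "ray_growth s F \<theta> \<longleftrightarrow> (\<exists>K\<ge>0. \<forall>t>0. norm (F (of_real t * cis \<theta>)) \<le> exp (K * (1 + t powr s)))"

lemma exp_powr_exp: "exp x powr s = exp (s * (x::real))"
  by (simp add: powr_def)

lemma Re_exp_scaled_ge:
  assumes "k \<ge> 0" "\<bar>Im w\<bar> \<le> \<beta>" "k * \<beta> < pi / 2"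
  shows "cos (k * \<beta>) * exp (k * Re w) \<le> Re (exp (of_real k * w))"
proof -
  have "k * \<bar>Im w\<bar> \<le> k * \<beta>" using assms by (intro mult_left_mono)
  then have "cos (k * \<beta>) \<le> cos (k * \<bar>Im w\<bar>)"
    using assms pi_gt_zero by (intro cos_monotone_0_pi_le) (simp, simp, linarith)
  also have "cos (k * \<bar>Im w\<bar>) = cos (k * Im w)"
    using cos_minus[of "k * Im w"] by (cases "Im w \<ge> 0") auto
  finally show ?thesis by (simp add: Re_exp mult.commute mult_right_mono)
qed

text \<open>Working with \<^term>\<open>G w = F (exp w)\<close> turns sectors into horizontal strips, so that the maximum
  principle applies to rectangles and the comparison functions \<^term>\<open>exp (of_real s * w)\<close> and
  \<^term>\<open>exp (of_real \<kappa> * w)\<close>, which stand for powers of \<open>z\<close>, are entire.\<close>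

lemma phragmen_lindelof_strip:
  fixes G :: "complex \<Rightarrow> complex"
  assumes G: "G holomorphic_on UNIV" and K: "K \<ge> 0" "\<And>w. norm (G w) \<le> exp (K * (1 + exp (\<tau> * Re w)))"
    and K1: "K1 \<ge> 0" "\<And>w. \<bar>Im w\<bar> = \<beta> \<Longrightarrow> norm (G w) \<le> exp (K1 * (1 + exp (s * Re w)))"
    and \<beta>: "\<beta> > 0" "\<kappa> * \<beta> < pi / 2" and par: "0 < \<tau>" "\<tau> < \<kappa>" "0 < s" "s < \<kappa>"
    and w: "\<bar>Im w\<bar> \<le> \<beta>"
  shows "norm (G w) \<le> exp (K1 + 2 * K + K1 / cos (s * \<beta>) * exp (s * Re w))"
proof -
  have sb: "s * \<beta> < pi / 2" using par \<beta> mult_strict_right_mono[of s \<kappa> \<beta>] by linarith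
  define cs where "cs = cos (s * \<beta>)"
  define ck where "ck = cos (\<kappa> * \<beta>)"
  have cs: "cs > 0" unfolding cs_def using par \<beta> sb by (intro cos_gt_zero_pi) (auto intro: less_trans[of _ 0])
  have ck: "ck > 0" unfolding ck_def using par \<beta> by (intro cos_gt_zero_pi) (auto intro: less_trans[of _ 0])
  define K2 where "K2 = K1 / cs"
  have K2: "K2 \<ge> 0" using K1 cs by (simp add: K2_def)
  have main: "norm (G w) \<le> exp (K1 + 2 * K + K2 * exp (s * Re w) + e * exp (\<kappa> * Re w))" if e: "e > 0" for e
  proof -
    \<comment> \<open>Two damping factors: \<open>K2\<close> satisfies K2 cos(s \<beta>) = K1 and
      cancels the growth on the two boundary lines, while the term with \<open>e\<close> and
      \<kappa> > \<tau> beats the a priori growth far to the right. Letting e tend to 0 removes the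
      latter.\<close>
    define H where "H v = G v * exp (- (of_real K2 * exp (of_real s * v)) - of_real e * exp (of_real \<kappa> * v))" for v
    have nH: "norm (H v) = norm (G v) * exp (- K2 * Re (exp (of_real s * v)) - e * Re (exp (of_real \<kappa> * v)))" for v
      by (simp add: H_def norm_mult)
    have Hle: "norm (H v) \<le> norm (G v) * exp (- K2 * cs * exp (s * Re v) - e * ck * exp (\<kappa> * Re v))" if "\<bar>Im v\<bar> \<le> \<beta>" for v
    proof -
      have "K2 * (cs * exp (s * Re v)) \<le> K2 * Re (exp (of_real s * v))"
        unfolding cs_def using par that sb K2 by (intro mult_left_mono Re_exp_scaled_ge) auto
      moreover have "e * (ck * exp (\<kappa> * Re v)) \<le> e * Re (exp (of_real \<kappa> * v))"
        unfolding ck_def using par that \<beta> e by (intro mult_left_mono Re_exp_scaled_ge) auto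
      ultimately show ?thesis unfolding nH by (intro mult_left_mono) (auto simp: mult.assoc)
    qed
    have "eventually (\<lambda>x. K * (1 + exp (\<tau> * x)) \<le> e * ck * exp (\<kappa> * x)) at_top"
    proof -
      have "((\<lambda>x. K * (exp (- \<kappa> * x) + exp ((\<tau> - \<kappa>) * x))) \<longlongrightarrow> K * (0 + 0)) at_top"
      proof (intro tendsto_intros)
        have *: "((\<lambda>x. exp (c * x)) \<longlongrightarrow> 0) at_top" if "c < 0" for c :: real
          by (rule filterlim_compose[OF exp_at_bot]) 
            (use that in \<open>auto intro!: filterlim_tendsto_neg_mult_at_bot[OF tendsto_const] filterlim_ident\<close>)
        show "((\<lambda>x. exp (- \<kappa> * x)) \<longlongrightarrow> 0) at_top" by (rule *) (use par in simp)
        show "((\<lambda>x. exp ((\<tau> - \<kappa>) * x)) \<longlongrightarrow> 0) at_top" by (rule *) (use par in simp)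
      qed
      then have "eventually (\<lambda>x. K * (exp (- \<kappa> * x) + exp ((\<tau> - \<kappa>) * x)) < e * ck) at_top"
        by (rule order_tendstoD) (use e ck in simp)
      then show ?thesis
      proof eventually_elim
        case (elim x)
        have "K * (1 + exp (\<tau> * x)) = K * (exp (- \<kappa> * x) + exp ((\<tau> - \<kappa>) * x)) * exp (\<kappa> * x)"
          by (simp add: algebra_simps exp_add[symmetric])
        also have "\<dots> \<le> e * ck * exp (\<kappa> * x)" using elim by (intro mult_right_mono) auto
        finally show ?case .
      qed
    qed
    then obtain b0 where b0: "\<And>x. x \<ge> b0 \<Longrightarrow> K * (1 + exp (\<tau> * x)) \<le> e * ck * exp (\<kappa> * x)"
      unfolding eventually_at_top_linorder by blast
    \<comment> \<open>The right edge lies far enough out for the term with \<open>e\<close> to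
      dominate. The left edge lies at negative real part, where exp(\<tau> Re v) <= 1; this produces
      the summand 2 K.\<close>
    define b where "b = max (b0 + 1) (\<bar>Re w\<bar> + 1)"
    define a where "a = - (\<bar>Re w\<bar> + 1)"
    define S where "S = cbox (Complex a (-\<beta>)) (Complex b \<beta>)"
    have "norm (H w) \<le> exp (K1 + 2 * K)"
    proof (rule maximum_modulus_frontier[of H S])
      have "H holomorphic_on UNIV" unfolding H_def by (intro holomorphic_intros G)
      then show "H holomorphic_on interior S" "continuous_on (closure S) H"
        by (auto intro: holomorphic_on_subset continuous_on_subset holomorphic_on_imp_continuous_on)
      show "bounded S" by (simp add: S_def)
      show "w \<in> S" using w by (auto simp: S_def in_cbox_complex_iff a_def b_def)
      fix v assume "v \<in> frontier S"
      then have v: "a \<le> Re v" "Re v \<le> b" "\<bar>Im v\<bar> \<le> \<beta>" and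
         cases: "\<bar>Im v\<bar> = \<beta> \<or> Re v = a \<or> Re v = b"
        by (auto simp: S_def frontier_cbox in_cbox_complex_iff in_box_complex_iff)
      note Hle' = Hle[OF v(3)]
      from cases consider "\<bar>Im v\<bar> = \<beta>" | "Re v = a" | "Re v = b" by blast
      then show "norm (H v) \<le> exp (K1 + 2 * K)"
      proof cases
        case 1
        have "norm (G v) * exp (- K2 * cs * exp (s * Re v) - e * ck * exp (\<kappa> * Re v))
           \<le> exp (K1 * (1 + exp (s * Re v))) * exp (- K2 * cs * exp (s * Re v))"
          using K1(2)[OF 1] e ck by (intro mult_mono) auto
        also have "\<dots> = exp K1" using cs by (simp add: K2_def exp_add[symmetric] algebra_simps)
        finally show ?thesis using Hle' K by (smt (verit) exp_le_cancel_iff)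
      next
        case 2
        have "exp (\<tau> * a) \<le> 1" using par by (simp add: a_def mult_nonneg_nonpos)
        have "norm (G v) * exp (- K2 * cs * exp (s * Re v) - e * ck * exp (\<kappa> * Re v))
           \<le> exp (K * (1 + exp (\<tau> * Re v))) * 1"
          proof (rule mult_mono[OF K(2)])
          have "0 \<le> K2 * cs * exp (s * Re v)" "0 \<le> e * ck * exp (\<kappa> * Re v)"
            using e ck K2 cs by auto
          then show "exp (- K2 * cs * exp (s * Re v) - e * ck * exp (\<kappa> * Re v)) \<le> 1" by simp
        qed auto
        also have "\<dots> \<le> exp (K * 2)" using 2 K \<open>exp (\<tau> * a) \<le> 1\<close> by (auto intro!: mult_left_mono)
        finally show ?thesis using Hle' K1 by (smt (verit) exp_le_cancel_iff)
      next
        case 3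
        have "norm (G v) * exp (- K2 * cs * exp (s * Re v) - e * ck * exp (\<kappa> * Re v))
           \<le> exp (K * (1 + exp (\<tau> * Re v))) * exp (- e * ck * exp (\<kappa> * Re v))"
          using K(2)[of v] K2 cs by (intro mult_mono) (auto simp: add_nonneg_nonneg)
        also have "\<dots> \<le> exp 0"
          using b0[of "Re v"] 3 by (simp only: exp_add[symmetric] exp_le_cancel_iff) (simp add: b_def)
        finally show ?thesis using Hle' K1 K by (smt (verit) exp_le_cancel_iff)
      qed
    qed
    moreover have "Re (exp (of_real s * w)) \<le> exp (s * Re w)" "Re (exp (of_real \<kappa> * w)) \<le> exp (\<kappa> * Re w)"
      by (simp_all add: Re_exp)
    then have "K2 * Re (exp (of_real s * w)) \<le> K2 * exp (s * Re w)" "e * Re (exp (of_real \<kappa> * w)) \<le> e * exp (\<kappa> * Re w)"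
      using K2 e by (auto intro!: mult_left_mono)
    then have "norm (G w) * exp (- K2 * exp (s * Re w) - e * exp (\<kappa> * Re w)) \<le> norm (H w)"
      unfolding nH by (intro mult_left_mono) auto
    ultimately have "norm (G w) * exp (- K2 * exp (s * Re w) - e * exp (\<kappa> * Re w)) \<le> exp (K1 + 2 * K)"
      by linarith
    then have "norm (G w) * exp (- K2 * exp (s * Re w) - e * exp (\<kappa> * Re w)) * exp (K2 * exp (s * Re w) + e * exp (\<kappa> * Re w))
      \<le> exp (K1 + 2 * K) * exp (K2 * exp (s * Re w) + e * exp (\<kappa> * Re w))"
      by (intro mult_right_mono) auto
    then show ?thesis by (simp only: mult.assoc exp_add[symmetric]) (simp add: algebra_simps)
  qed
  have "norm (G w) \<le> exp (K1 + 2 * K + K2 * exp (s * Re w))"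
  proof (rule tendsto_lowerbound)
    show "((\<lambda>e. exp (K1 + 2 * K + K2 * exp (s * Re w) + e * exp (\<kappa> * Re w))) \<longlongrightarrow>
       exp (K1 + 2 * K + K2 * exp (s * Re w))) (at_right 0)"
      by (auto intro!: tendsto_eq_intros)
    show "eventually (\<lambda>e. norm (G w) \<le> exp (K1 + 2 * K + K2 * exp (s * Re w) + e * exp (\<kappa> * Re w))) (at_right 0)"
      using eventually_at_right_less[of 0] by eventually_elim (rule main)
  qed simp
  then show ?thesis by (simp add: K2_def cs_def)
qed

lemma phragmen_lindelof_sector:
  fixes F :: "complex \<Rightarrow> complex"
  assumes F: "F holomorphic_on UNIV" and gr: "exp_growth \<tau> F"
    and rays: "ray_growth s F \<theta>1" "ray_growth s F \<theta>2" and th: "\<theta>1 < \<theta>2" "\<kappa> * (\<theta>2 - \<theta>1) < pi"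
    and par: "0 < \<tau>" "\<tau> < \<kappa>" "0 < s" "s < \<kappa>"
  obtains K where "K \<ge> 0"
    "\<And>\<theta> t. \<theta>1 \<le> \<theta> \<Longrightarrow> \<theta> \<le> \<theta>2 \<Longrightarrow> t > 0 \<Longrightarrow> norm (F (of_real t * cis \<theta>)) \<le> exp (K * (1 + t powr s))"
proof -
  obtain K where K: "K \<ge> 0" "\<And>z. norm (F z) \<le> exp (K * (1 + norm z powr \<tau>))"
    using gr unfolding exp_growth_def by blast
  obtain k1 where k1: "k1 \<ge> 0" "\<And>t. t > 0 \<Longrightarrow> norm (F (of_real t * cis \<theta>1)) \<le> exp (k1 * (1 + t powr s))"
    using rays unfolding ray_growth_def by blast
  obtain k2 where k2: "k2 \<ge> 0" "\<And>t. t > 0 \<Longrightarrow> norm (F (of_real t * cis \<theta>2)) \<le> exp (k2 * (1 + t powr s))"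
    using rays unfolding ray_growth_def by blast
  \<comment> \<open>Rotating by the bisector \<open>\<phi>\<close> makes the strip symmetric, with
    half-opening \<open>\<beta>\<close>.\<close>
  define \<phi> where "\<phi> = (\<theta>1 + \<theta>2) / 2"
  define \<beta> where "\<beta> = (\<theta>2 - \<theta>1) / 2"
  define G where "G w = F (exp (w + \<i> * of_real \<phi>))" for w
  have Gv: "G w = F (of_real (exp (Re w)) * cis (Im w + \<phi>))" for w
    unfolding G_def exp_eq_polar by simp
  define K1 where "K1 = max k1 k2"
  define B where "B = K1 + 2 * K + K1 / cos (s * \<beta>)"
  have \<beta>: "\<beta> > 0" "\<kappa> * \<beta> < pi / 2" using th by (auto simp: \<beta>_def field_simps)
  have "s * \<beta> < pi / 2" using par \<beta> mult_strict_right_mono[of s \<kappa> \<beta>] by linarith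
  then have cs: "cos (s * \<beta>) > 0" using par \<beta> by (intro cos_gt_zero_pi) (auto intro: less_trans[of _ 0])
  have K1: "K1 \<ge> 0" using k1 by (simp add: K1_def)
  have q: "K1 / cos (s * \<beta>) \<ge> 0" using cs K1 by simp
  have st: "norm (G w) \<le> exp (K1 + 2 * K + K1 / cos (s * \<beta>) * exp (s * Re w))" if "\<bar>Im w\<bar> \<le> \<beta>" for w
  proof (rule phragmen_lindelof_strip[where \<tau> = \<tau> and \<kappa> = \<kappa> and \<beta> = \<beta>])
    show "G holomorphic_on UNIV"
    proof -
      have "(F \<circ> (\<lambda>w. exp (w + \<i> * of_real \<phi>))) holomorphic_on UNIV"
        by (rule holomorphic_on_compose_gen[OF _ F]) (auto intro!: holomorphic_intros)
      then show ?thesis unfolding G_def o_def .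
    qed
    show "norm (G v) \<le> exp (K * (1 + exp (\<tau> * Re v)))" for v
      using K(2)[of "exp (v + \<i> * of_real \<phi>)"] by (simp add: G_def exp_powr_exp)
    show "norm (G v) \<le> exp (K1 * (1 + exp (s * Re v)))" if "\<bar>Im v\<bar> = \<beta>" for v
    proof -
      from that \<beta> consider "Im v = \<beta>" | "Im v = -\<beta>" by linarith
      then show ?thesis
      proof cases
        case 1
        then have "Im v + \<phi> = \<theta>2" by (simp add: \<beta>_def \<phi>_def field_simps)
        then have "norm (G v) \<le> exp (k2 * (1 + exp (s * Re v)))"
          using k2(2)[of "exp (Re v)"] by (simp add: Gv exp_powr_exp)
        also have "\<dots> \<le> exp (K1 * (1 + exp (s * Re v)))"
          by (auto simp: K1_def intro!: mult_right_mono add_nonneg_nonneg)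
        finally show ?thesis .
      next
        case 2
        then have "Im v + \<phi> = \<theta>1" by (simp add: \<beta>_def \<phi>_def field_simps)
        then have "norm (G v) \<le> exp (k1 * (1 + exp (s * Re v)))"
          using k1(2)[of "exp (Re v)"] by (simp add: Gv exp_powr_exp)
        also have "\<dots> \<le> exp (K1 * (1 + exp (s * Re v)))"
          by (auto simp: K1_def intro!: mult_right_mono add_nonneg_nonneg)
        finally show ?thesis .
      qed
    qed
  qed (use K K1 \<beta> par that in auto)
  show ?thesis
  proof (rule that[of B])
    show "B \<ge> 0" unfolding B_def using K K1 q by simp
    fix \<theta> t :: real assume *: "\<theta>1 \<le> \<theta>" "\<theta> \<le> \<theta>2" "t > 0"
    define w where "w = Complex (ln t) (\<theta> - \<phi>)"
    have "\<bar>Im w\<bar> \<le> \<beta>" using * by (auto simp: w_def \<phi>_def \<beta>_def abs_le_iff field_simps)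
    from st[OF this] have "norm (F (of_real t * cis \<theta>)) \<le> exp (K1 + 2 * K + K1 / cos (s * \<beta>) * t powr s)"
      using * by (simp add: Gv w_def powr_def)
    also have "\<dots> \<le> exp (B * (1 + t powr s))"
    proof -
      have "0 \<le> (K1 + 2 * K) * t powr s" using K K1 by (intro mult_nonneg_nonneg) auto
      moreover have "B * (1 + t powr s) = K1 + 2 * K + (K1 + 2 * K) * t powr s
          + K1 / cos (s * \<beta>) + K1 / cos (s * \<beta>) * t powr s"
        unfolding B_def by (simp only: algebra_simps)
      ultimately show ?thesis using q unfolding exp_le_cancel_iff by linarith
    qed
    finally show "norm (F (of_real t * cis \<theta>)) \<le> exp (B * (1 + t powr s))" .
  qed
qed

text \<open>The constant in Phragmen-Lindelof depends on the sector; compactness of the interval of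
  directions leaves finitely many sectors, whose constants can be summed.\<close>

lemma exp_growth_from_rays:
  fixes F :: "complex \<Rightarrow> complex"
  assumes F: "F holomorphic_on UNIV" and gr: "exp_growth \<tau> F"
    and par: "0 < \<tau>" "\<tau> < \<kappa>" "0 < s" "s < \<kappa>"
    and rays: "\<And>\<theta>. \<exists>\<theta>1 \<theta>2. \<theta>1 < \<theta> \<and> \<theta> < \<theta>2 \<and> \<kappa> * (\<theta>2 - \<theta>1) < pi \<and> ray_growth s F \<theta>1 \<and> ray_growth s F \<theta>2"
  shows "exp_growth s F"
proof -
  have "\<exists>U K. open U \<and> \<theta> \<in> U \<and> K \<ge> 0 \<and>
     (\<forall>\<theta>'\<in>U. \<forall>t>0. norm (F (of_real t * cis \<theta>')) \<le> exp (K * (1 + t powr s)))" for \<theta>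
  proof -
    obtain \<theta>1 \<theta>2 where t: "\<theta>1 < \<theta>" "\<theta> < \<theta>2" "\<kappa> * (\<theta>2 - \<theta>1) < pi" "ray_growth s F \<theta>1" "ray_growth s F \<theta>2"
      using rays by blast
    have "\<theta>1 < \<theta>2" using t by linarith
    from phragmen_lindelof_sector[OF F gr t(4,5) this t(3) par]
    obtain K where "K \<ge> 0" "\<And>\<theta> t. \<theta>1 \<le> \<theta> \<Longrightarrow> \<theta> \<le> \<theta>2 \<Longrightarrow> t > 0 \<Longrightarrow> norm (F (of_real t * cis \<theta>)) \<le> exp (K * (1 + t powr s))"
      by blast
    then show ?thesis using t by (intro exI[of _ "{\<theta>1<..<\<theta>2}"] exI[of _ K]) auto
  qed
  then obtain U K where UK: "\<And>\<theta>. open (U \<theta>)" "\<And>\<theta>::real. \<theta> \<in> U \<theta>" "\<And>\<theta>. K \<theta> \<ge> (0::real)"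
     "\<And>\<theta> \<theta>' t. \<theta>' \<in> U \<theta> \<Longrightarrow> t > 0 \<Longrightarrow> norm (F (of_real t * cis \<theta>')) \<le> exp (K \<theta> * (1 + t powr s))"
    by metis
  have "{0..2*pi} \<subseteq> \<Union>(range U)" using UK(2) by auto
  then obtain D' where D': "D' \<subseteq> range U" "finite D'" "{0..2*pi} \<subseteq> \<Union>D'"
    by (rule compactE[OF compact_Icc]) (use UK(1) in auto)
  obtain D where D: "finite D" "D' = U ` D" using finite_subset_image[OF D'(2,1)] by blast
  \<comment> \<open>Rays only see t > 0, so the value at the origin gets its own summand.\<close>
  define k where "k = (\<Sum>\<theta>\<in>D. K \<theta>) + \<bar>ln (norm (F 0))\<bar>"
  have k0: "k \<ge> 0" using UK(3) by (simp add: k_def sum_nonneg)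
  have "norm (F z) \<le> exp (k * (1 + norm z powr s))" for z
  proof (cases "z = 0")
    case True
    have "norm (F 0) \<le> exp \<bar>ln (norm (F 0))\<bar>"
    proof (cases "F 0 = 0")
      case False
      then have "norm (F 0) = exp (ln (norm (F 0)))" by simp
      also have "\<dots> \<le> exp \<bar>ln (norm (F 0))\<bar>" by (subst exp_le_cancel_iff) simp
      finally show ?thesis .
    qed simp
    also have "\<dots> \<le> exp k" using UK(3) by (simp add: k_def sum_nonneg)
    finally show ?thesis using True par by simp
  next
    case False
    have "Arg2pi z \<in> {0..2*pi}" using Arg2pi_ge_0[of z] Arg2pi_lt_2pi[of z] by simp
    then obtain \<theta> where \<theta>: "\<theta> \<in> D" "Arg2pi z \<in> U \<theta>" using D' D by auto
    have zz: "of_real (norm z) * cis (Arg2pi z) = z"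
      using Arg2pi_eq[of z] by (simp add: cis_conv_exp)
    have "norm (F z) \<le> exp (K \<theta> * (1 + norm z powr s))"
      using UK(4)[OF \<theta>(2), of "norm z"] False unfolding zz by simp
    also have "\<dots> \<le> exp (k * (1 + norm z powr s))"
      using member_le_sum[OF \<theta>(1), of K] UK(3) D(1)
      by (auto simp: k_def intro!: mult_right_mono)
    finally show ?thesis .
  qed
  then show ?thesis using k0 unfolding exp_growth_def by blast
qed

lemma ray_growthI_eventually:
  assumes gr: "exp_growth \<tau> F" and par: "0 < \<tau>" "0 < s" "B \<ge> 0"
    and ev: "eventually (\<lambda>t. norm (F (of_real t * cis \<theta>)) \<le> exp (B * (1 + t powr s))) at_top"
  shows "ray_growth s F \<theta>"
proof -
  obtain K where K: "K \<ge> 0" "\<And>z. norm (F z) \<le> exp (K * (1 + norm z powr \<tau>))"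
    using gr unfolding exp_growth_def by blast
  obtain T where T: "\<And>t. t \<ge> T \<Longrightarrow> norm (F (of_real t * cis \<theta>)) \<le> exp (B * (1 + t powr s))"
    using ev unfolding eventually_at_top_linorder by blast
  define k where "k = B + K * (1 + \<bar>T\<bar> powr \<tau>)"
  have "norm (F (of_real t * cis \<theta>)) \<le> exp (k * (1 + t powr s))" if t: "t > 0" for t
  proof (cases "t \<ge> T")
    case True
    have "norm (F (of_real t * cis \<theta>)) \<le> exp (B * (1 + t powr s))" using T True .
    also have "\<dots> \<le> exp (k * (1 + t powr s))"
      using K(1) by (auto simp: k_def intro!: mult_right_mono)
    finally show ?thesis .
  next
    case False
    have "t powr \<tau> \<le> \<bar>T\<bar> powr \<tau>" using False t par by (intro powr_mono2) auto
    then have "norm (F (of_real t * cis \<theta>)) \<le> exp (K * (1 + \<bar>T\<bar> powr \<tau>))"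
      using K t by (intro order_trans[OF K(2)]) (auto simp: norm_mult intro!: mult_left_mono)
    also have "K * (1 + \<bar>T\<bar> powr \<tau>) \<le> k * 1" using par by (simp add: k_def)
    also have "k * 1 \<le> k * (1 + t powr s)"
      using K par by (intro mult_left_mono) (auto simp: k_def)
    finally show ?thesis by simp
  qed
  moreover have "k \<ge> 0" using K par by (simp add: k_def)
  ultimately show ?thesis unfolding ray_growth_def by blast
qed

section \<open>Order and growth\<close>

lemma eventually_powr_dominated:
  fixes A B s s' \<delta> :: real
  assumes "s < s'" "0 < s'" "\<delta> > 0"
  shows "eventually (\<lambda>t. A + B * t powr s \<le> \<delta> * t powr s') at_top"
proof -
  have "((\<lambda>t. A * t powr (- s') + B * t powr (s - s')) \<longlongrightarrow> A * 0 + B * 0) at_top"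
    using assms by (intro tendsto_intros tendsto_neg_powr filterlim_ident) auto
  then have "eventually (\<lambda>t. A * t powr (- s') + B * t powr (s - s') < \<delta>) at_top"
    by (rule order_tendstoD) (use assms in simp)
  then show ?thesis using eventually_gt_at_top[of 0]
  proof eventually_elim
    case (elim t)
    have "A + B * t powr s = (A * t powr (- s') + B * t powr (s - s')) * t powr s'"
      using elim by (simp add: algebra_simps powr_add[symmetric])
    also have "\<dots> \<le> \<delta> * t powr s'" using elim by (intro mult_right_mono) auto
    finally show ?case .
  qed
qed

lemma logp_mono: "x \<le> y \<Longrightarrow> logp x \<le> logp y"
  by (auto simp: logp_def)

lemma le_exp_logp: "x \<le> exp (logp x)"
  by (auto simp: logp_def)

lemma norm_le_max_mod:
  assumes "g holomorphic_on UNIV"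
  shows "norm (g z) \<le> max_mod (norm z) g"
  unfolding max_mod_def
proof (rule cSUP_upper)
  have "continuous_on (sphere 0 (norm z)) (\<lambda>z. norm (g z))"
    by (intro continuous_intros continuous_on_subset[OF holomorphic_on_imp_continuous_on[OF assms]]) auto
  then have "compact ((\<lambda>z. norm (g z)) ` sphere 0 (norm z))"
    by (rule compact_continuous_image) simp
  then show "bdd_above ((\<lambda>z. norm (g z)) ` sphere 0 (norm z))"
    by (simp add: bounded_imp_bdd_above compact_imp_bounded)
qed simp

lemma exp_growth_of_ent_order:
  assumes g: "g holomorphic_on UNIV" and ord: "ent_order g < ereal \<tau>" and \<tau>: "\<tau> > 0"
  shows "exp_growth \<tau> g"
proof -
  have "eventually (\<lambda>r. ereal (logp (logp (max_mod r g)) / ln r) < ereal \<tau>) at_top"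
    using ord unfolding ent_order_def by (rule Limsup_lessD)
  then have "eventually (\<lambda>r. max_mod r g \<le> exp (r powr \<tau>)) at_top"
    using eventually_gt_at_top[of 1]
  proof eventually_elim
    case (elim r)
    have l: "logp (logp (max_mod r g)) < \<tau> * ln r"
      using elim by (simp add: pos_divide_less_eq)
    have "logp (max_mod r g) \<le> exp (logp (logp (max_mod r g)))" by (rule le_exp_logp)
    also have "\<dots> \<le> exp (\<tau> * ln r)" using l by simp
    also have "\<dots> = r powr \<tau>" using elim by (simp add: powr_def)
    finally show ?case using le_exp_logp[of "max_mod r g"] by (meson exp_le_cancel_iff order_trans)
  qed
  then obtain T where T: "\<And>r. r \<ge> T \<Longrightarrow> max_mod r g \<le> exp (r powr \<tau>)"
    unfolding eventually_at_top_linorder by blast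
  have "compact (g ` cball 0 T)"
    using g by (intro compact_continuous_image continuous_on_subset[OF holomorphic_on_imp_continuous_on]) auto
  then obtain B where B: "\<And>z. norm z \<le> T \<Longrightarrow> norm (g z) \<le> B"
    using compact_imp_bounded[of "g ` cball 0 T"] unfolding bounded_iff by (metis imageI mem_cball_0)
  define K where "K = 1 + \<bar>B\<bar>"
  have "norm (g z) \<le> exp (K * (1 + norm z powr \<tau>))" for z
  proof (cases "norm z \<le> T")
    case True
    have "norm (g z) \<le> K" using B[OF True] by (simp add: K_def)
    also have "\<dots> \<le> exp K" using exp_ge_add_one_self[of K] by linarith
    also have "\<dots> \<le> exp (K * (1 + norm z powr \<tau>))" using mult_left_mono[of 1 "1 + norm z powr \<tau>" K] by (simp add: K_def)
    finally show ?thesis .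
  next
    case False
    have "norm (g z) \<le> exp (norm z powr \<tau>)" using norm_le_max_mod[OF g, of z] T[of "norm z"] False by simp
    also have "\<dots> \<le> exp (K * (1 + norm z powr \<tau>))"
      using mult_mono[of 1 K "norm z powr \<tau>" "1 + norm z powr \<tau>"] by (simp add: K_def)
    finally show ?thesis .
  qed
  then show ?thesis unfolding exp_growth_def by (intro exI[of _ K]) (simp add: K_def)
qed

lemma ent_order_le_of_exp_growth:
  assumes gr: "exp_growth s g" and s: "0 < s" "s < s'"
  shows "ent_order g \<le> ereal s'"
proof -
  obtain K where K: "K \<ge> 0" "\<And>z. norm (g z) \<le> exp (K * (1 + norm z powr s))"
    using gr unfolding exp_growth_def by blast
  have "eventually (\<lambda>r. K + K * r powr s \<le> 1 * r powr s') at_top"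
    by (rule eventually_powr_dominated) (use s in auto)
  then have "eventually (\<lambda>r. ereal (logp (logp (max_mod r g)) / ln r) \<le> ereal s') at_top"
    using eventually_gt_at_top[of 1]
  proof eventually_elim
    case (elim r)
    have "max_mod r g \<le> exp (K * (1 + r powr s))"
      unfolding max_mod_def
    proof (rule cSUP_least)
      show "sphere (0::complex) r \<noteq> {}" using elim by simp
      show "norm (g z) \<le> exp (K * (1 + r powr s))" if "z \<in> sphere 0 r" for z
        using K(2)[of z] that by simp
    qed
    also have "\<dots> \<le> exp (r powr s')" using elim by (simp add: algebra_simps)
    finally have "logp (max_mod r g) \<le> logp (exp (r powr s'))" by (rule logp_mono)
    also have "\<dots> \<le> r powr s'" by (simp add: logp_def)
    finally have "logp (logp (max_mod r g)) \<le> logp (r powr s')" by (rule logp_mono)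
    also have "\<dots> \<le> s' * ln r" using elim s by (auto simp: logp_def ln_powr)
    finally show ?case using elim by (simp add: pos_divide_le_eq)
  qed
  then show ?thesis unfolding ent_order_def by (rule Limsup_bounded)
qed

lemma ent_order_nonneg: "0 \<le> ent_order g"
  unfolding ent_order_def
proof (rule le_Limsup)
  show "eventually (\<lambda>r. 0 \<le> ereal (logp (logp (max_mod r g)) / ln r)) at_top"
    using eventually_gt_at_top[of 1] by eventually_elim (auto simp: logp_def intro!: divide_nonneg_nonneg)
qed simp

text \<open>Cauchy's estimate on unit discs changes the constant but not the exponent.\<close>

lemma exp_growth_deriv:
  assumes F: "F holomorphic_on UNIV" and gr: "exp_growth s F" and s: "s > 0"
  shows "exp_growth s (deriv F)"
proof -
  obtain K where K: "K \<ge> 0" "\<And>z. norm (F z) \<le> exp (K * (1 + norm z powr s))"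
    using gr unfolding exp_growth_def by blast
  have "norm (deriv F z) \<le> exp (K * (1 + 2 powr s) * (1 + norm z powr s))" for z
  proof -
    have "norm ((deriv ^^ 1) F z) \<le> fact 1 * exp (K * (1 + (norm z + 1) powr s)) / 1 ^ 1"
    proof (rule Cauchy_inequality)
      show "F holomorphic_on ball z 1" "continuous_on (cball z 1) F"
        using F by (auto intro: holomorphic_on_subset continuous_on_subset holomorphic_on_imp_continuous_on)
      fix x assume "norm (z - x) = 1"
      then have "norm x \<le> norm z + 1" using norm_triangle_ineq4[of z "z - x"] by simp
      then have "norm x powr s \<le> (norm z + 1) powr s" using s by (intro powr_mono2) auto
      then show "norm (F x) \<le> exp (K * (1 + (norm z + 1) powr s))"
        using K(1) by (intro order_trans[OF K(2)[of x]]) (auto intro!: mult_left_mono)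
    qed simp
    then have "norm (deriv F z) \<le> exp (K * (1 + (norm z + 1) powr s))" by simp
    also have "\<dots> \<le> exp (K * ((1 + 2 powr s) * (1 + norm z powr s)))"
    proof -
      have "(norm z + 1) powr s \<le> 2 powr s * (1 + norm z powr s)"
      proof (cases "norm z \<le> 1")
        case True
        then have "(norm z + 1) powr s \<le> 2 powr s * 1" using s by (auto intro!: powr_mono2)
        also have "\<dots> \<le> 2 powr s * (1 + norm z powr s)" by (intro mult_left_mono) auto
        finally show ?thesis .
      next
        case False
        then have "(norm z + 1) powr s \<le> (2 * norm z) powr s" using s by (auto intro!: powr_mono2)
        also have "\<dots> = 2 powr s * norm z powr s" by (simp add: powr_mult)
        also have "\<dots> \<le> 2 powr s * (1 + norm z powr s)" by (intro mult_left_mono) auto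
        finally show ?thesis .
      qed
      moreover have "(1 + 2 powr s) * (1 + norm z powr s) = 1 + norm z powr s + 2 powr s * (1 + norm z powr s)"
        by (simp add: algebra_simps)
      ultimately have "1 + (norm z + 1) powr s \<le> (1 + 2 powr s) * (1 + norm z powr s)"
        using powr_ge_zero[of "norm z" s] by linarith
      then show ?thesis using K(1) by (auto intro!: mult_left_mono)
    qed
    finally show ?thesis by (simp add: mult.assoc)
  qed
  then show ?thesis unfolding exp_growth_def using K(1)
    by (intro exI[of _ "K * (1 + 2 powr s)"]) auto
qed

lemma exp_growth_ray:
  assumes "exp_growth s F" "0 < s" "s < s'"
  shows "eventually (\<lambda>t. norm (F (of_real t * cis \<theta>)) \<le> exp (t powr s')) at_top"
proof -
  obtain K where K: "K \<ge> 0" "\<And>z. norm (F z) \<le> exp (K * (1 + norm z powr s))"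
    using assms unfolding exp_growth_def by blast
  have "eventually (\<lambda>t. K + K * t powr s \<le> 1 * t powr s') at_top"
    by (rule eventually_powr_dominated) (use assms in auto)
  then show ?thesis using eventually_gt_at_top[of 0]
  proof eventually_elim
    case (elim t)
    have "norm (F (of_real t * cis \<theta>)) \<le> exp (K * (1 + t powr s))"
      using K(2)[of "of_real t * cis \<theta>"] elim by (simp add: norm_mult)
    also have "\<dots> \<le> exp (t powr s')" using elim by (simp add: algebra_simps)
    finally show ?case .
  qed
qed

section \<open>Polynomially counted zero sets and the rays that avoid them\<close>

definition poly_count :: "complex set \<Rightarrow> bool" where
  "poly_count Z \<longleftrightarrow> (\<exists>T C N. \<forall>r\<ge>T. finite (Z \<inter> cball 0 r) \<and> real (card (Z \<inter> cball 0 r)) \<le> C * r ^ N)"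

definition avoids :: "complex set \<Rightarrow> nat \<Rightarrow> real \<Rightarrow> bool" where
  "avoids Z N \<theta> \<longleftrightarrow> eventually (\<lambda>t. \<forall>a\<in>Z. 1 / t ^ N \<le> norm (of_real t * cis \<theta> - a)) at_top"

lemma poly_count_zeros:
  assumes "F holomorphic_on UNIV" "\<exists>z. F z \<noteq> 0" "s > 0" "exp_growth s F"
  shows "poly_count {a. F a = 0}"
proof -
  obtain C T where CT: "C > 0" "T \<ge> 1"
    "\<forall>r\<ge>T. finite {a \<in> cball 0 r. F a = 0} \<and> real (card {a \<in> cball 0 r. F a = 0}) \<le> C * r powr s"
    by (rule estimates_away_from_zeros[OF assms]) (rule that)
  have eq: "{a. F a = 0} \<inter> cball 0 r = {a \<in> cball 0 r. F a = 0}" for r by auto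
  have "C * r powr s \<le> C * r ^ nat \<lceil>s\<rceil>" if "r \<ge> T" for r
  proof -
    have "r powr s \<le> r powr (real (nat \<lceil>s\<rceil>))" using that CT(2) by (intro powr_mono real_nat_ceiling_ge) auto
    also have "\<dots> = r ^ nat \<lceil>s\<rceil>" using that CT(2) by (simp add: powr_realpow)
    finally show ?thesis using CT(1) by simp
  qed
  then show ?thesis unfolding poly_count_def eq using CT(3) by (meson order_trans)
qed

text \<open>The free exponent in \<open>poly_count\<close> lets zero sets of functions with
  different growth be merged, so that one ray can avoid all of them at once.\<close>

lemma poly_count_Un:
  assumes "poly_count A" "poly_count B"
  shows "poly_count (A \<union> B)"
proof -
  obtain T C N where 1: "\<And>r. r \<ge> T \<Longrightarrow> finite (A \<inter> cball 0 r) \<and> real (card (A \<inter> cball 0 r)) \<le> C * r ^ N"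
    using assms(1) unfolding poly_count_def by blast
  obtain T' C' N' where 2: "\<And>r. r \<ge> T' \<Longrightarrow> finite (B \<inter> cball 0 r) \<and> real (card (B \<inter> cball 0 r)) \<le> C' * r ^ N'"
    using assms(2) unfolding poly_count_def by blast
  have "finite ((A \<union> B) \<inter> cball 0 r) \<and> real (card ((A \<union> B) \<inter> cball 0 r)) \<le> (\<bar>C\<bar> + \<bar>C'\<bar>) * r ^ (N + N')"
    if r: "r \<ge> max 1 (max T T')" for r
  proof
    have eq: "(A \<union> B) \<inter> cball 0 r = (A \<inter> cball 0 r) \<union> (B \<inter> cball 0 r)" by auto
    show "finite ((A \<union> B) \<inter> cball 0 r)" unfolding eq using 1[of r] 2[of r] r by auto
    have "real (card ((A \<union> B) \<inter> cball 0 r)) \<le> real (card (A \<inter> cball 0 r)) + real (card (B \<inter> cball 0 r))"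
      unfolding eq using card_Un_le[of "A \<inter> cball 0 r" "B \<inter> cball 0 r"] by linarith
    also have "real (card (A \<inter> cball 0 r)) \<le> C * r ^ N" using 1[of r] r by auto
    also have "C * r ^ N \<le> \<bar>C\<bar> * r ^ (N + N')" using r by (intro mult_mono power_increasing) auto
    also have "real (card (B \<inter> cball 0 r)) \<le> C' * r ^ N'" using 2[of r] r by auto
    also have "C' * r ^ N' \<le> \<bar>C'\<bar> * r ^ (N + N')" using r by (intro mult_mono power_increasing) auto
    finally show "real (card ((A \<union> B) \<inter> cball 0 r)) \<le> (\<bar>C\<bar> + \<bar>C'\<bar>) * r ^ (N + N')" by (simp add: algebra_simps)
  qed
  then show ?thesis unfolding poly_count_def by blast
qed

text \<open>\<open>N\<close> is fixed before the interval, so one power of t serves for all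
  directions.\<close>

lemma avoids_dense:
  assumes "poly_count Z"
  obtains N where "\<And>x y. x < y \<Longrightarrow> \<exists>\<theta>. x < \<theta> \<and> \<theta> < y \<and> avoids Z N \<theta>"
proof -
  obtain T C N where 1: "\<And>r. r \<ge> T \<Longrightarrow> finite (Z \<inter> cball 0 r) \<and> real (card (Z \<inter> cball 0 r)) \<le> C * r ^ N"
    using assms(1) unfolding poly_count_def by blast
  have "\<exists>\<theta>. x < \<theta> \<and> \<theta> < y \<and> avoids Z (N+2) \<theta>" if "x < y" for x y
  proof -
    obtain \<theta> where "x < \<theta>" "\<theta> < y"
      "eventually (\<lambda>t. \<forall>a\<in>Z. 1 / t ^ (N+2) \<le> norm (of_real t * cis \<theta> - a)) at_top"
      by (rule ray_avoiding_set[of T Z C N, OF _ \<open>x < y\<close>]) (use 1 in blast, rule that)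
    then show ?thesis unfolding avoids_def by blast
  qed
  then show ?thesis by (rule that)
qed

text \<open>At distance d = t^(-N) from the zeros, 1/d costs a power of t in the logarithmic
  derivative, and -ln d costs only a multiple of ln t in the lower bound; the gap between
  \<open>s\<close> and \<open>s'\<close> absorbs that logarithm.\<close>

lemma ray_estimates:
  assumes F: "F holomorphic_on UNIV" "\<exists>z. F z \<noteq> 0" "s > 0" "exp_growth s F"
    and av: "avoids Z N \<theta>" "\<And>a. F a = 0 \<Longrightarrow> a \<in> Z"
  shows "\<exists>p. eventually (\<lambda>t. norm (deriv F (of_real t * cis \<theta>)) \<le> t ^ p * norm (F (of_real t * cis \<theta>))) at_top"
    and "s < s' \<Longrightarrow> eventually (\<lambda>t. exp (- (t powr s')) \<le> norm (F (of_real t * cis \<theta>))) at_top"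
proof -
  obtain C T where CT: "C > 0" "T \<ge> 1"
     and est: "\<forall>z d. norm z \<ge> T \<and> 0 < d \<and> d \<le> 1 \<and> (\<forall>a. F a = 0 \<longrightarrow> d \<le> norm (z - a)) \<longrightarrow>
       norm (deriv F z) \<le> C * norm z powr s / d * norm (F z) \<and>
       exp (- C * norm z powr s * (1 + ln (norm z) - ln d)) \<le> norm (F z)"
    by (rule estimates_away_from_zeros[OF F]) (rule that)
  have ev: "eventually (\<lambda>t. norm (deriv F (of_real t * cis \<theta>)) \<le> C * t powr s * t ^ N * norm (F (of_real t * cis \<theta>)) \<and>
       exp (- C * t powr s * (1 + real (N + 1) * ln t)) \<le> norm (F (of_real t * cis \<theta>))) at_top"
    using av(1)[unfolded avoids_def] eventually_ge_at_top[of T]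
  proof eventually_elim
    case (elim t)
    have t: "t \<ge> 1" "norm (of_real t * cis \<theta>) = t" using elim CT by (auto simp: norm_mult)
    have "norm (deriv F (of_real t * cis \<theta>)) \<le> C * t powr s / (1 / t ^ N) * norm (F (of_real t * cis \<theta>)) \<and>
       exp (- C * t powr s * (1 + ln t - ln (1 / t ^ N))) \<le> norm (F (of_real t * cis \<theta>))"
      using est[rule_format, of "of_real t * cis \<theta>" "1 / t ^ N"] elim av(2) t one_le_power[OF t(1), of N] by auto
    moreover have "1 + ln t - ln (1 / t ^ N) = 1 + real (N + 1) * ln t"
      using t by (simp add: ln_div ln_realpow algebra_simps)
    ultimately show ?case by simp
  qed
  define p where "p = 1 + nat \<lceil>s\<rceil> + N"
  show "\<exists>p. eventually (\<lambda>t. norm (deriv F (of_real t * cis \<theta>)) \<le> t ^ p * norm (F (of_real t * cis \<theta>))) at_top"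
  proof (rule exI[of _ p])
    show "eventually (\<lambda>t. norm (deriv F (of_real t * cis \<theta>)) \<le> t ^ p * norm (F (of_real t * cis \<theta>))) at_top"
      using ev eventually_ge_at_top[of "max 1 C"]
    proof eventually_elim
      case (elim t)
      have t: "t \<ge> 1" "t \<ge> C" using elim by auto
      have "t powr s \<le> t powr (real (nat \<lceil>s\<rceil>))" using t by (intro powr_mono real_nat_ceiling_ge) auto
      also have "\<dots> = t ^ nat \<lceil>s\<rceil>" using t by (simp add: powr_realpow)
      finally have "C * t powr s * t ^ N \<le> t * t ^ nat \<lceil>s\<rceil> * t ^ N"
        using t CT by (intro mult_mono) auto
      also have "\<dots> = t ^ p" by (simp add: p_def power_add)
      finally show ?case using elim by (meson mult_right_mono norm_ge_zero order_trans)
    qed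
  qed
  assume ss: "s < s'"
  \<comment> \<open>Half of the gap pays for ln t <= t^a / a, the other half for the constant
    \<open>D\<close>.\<close>
  define a where "a = (s' - s) / 2"
  have a: "a > 0" "s + a < s'" using ss by (auto simp: a_def field_simps)
  define D where "D = C * (1 + real (N + 1) / a)"
  have "eventually (\<lambda>t. 0 + D * t powr (s + a) \<le> 1 * t powr s') at_top"
    by (rule eventually_powr_dominated) (use a F(3) in auto)
  then show "eventually (\<lambda>t. exp (- (t powr s')) \<le> norm (F (of_real t * cis \<theta>))) at_top"
    using ev eventually_ge_at_top[of 1]
  proof eventually_elim
    case (elim t)
    have "ln t \<le> t powr a / a" by (rule ln_powr_bound) (use elim a in auto)
    then have "real (N + 1) * ln t \<le> real (N + 1) * (t powr a / a)" by (intro mult_left_mono) auto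
    moreover have "1 \<le> t powr a" using elim a by (simp add: ge_one_powr_ge_zero)
    ultimately have "1 + real (N + 1) * ln t \<le> (1 + real (N + 1) / a) * t powr a"
      by (simp add: algebra_simps)
    then have "C * t powr s * (1 + real (N + 1) * ln t) \<le> C * t powr s * ((1 + real (N + 1) / a) * t powr a)"
      using CT by (intro mult_left_mono) auto
    also have "\<dots> = D * t powr (s + a)" by (simp add: D_def powr_add)
    also have "\<dots> \<le> t powr s'" using elim by simp
    finally have "exp (- (t powr s')) \<le> exp (- C * t powr s * (1 + real (N + 1) * ln t))" by simp
    then show ?case using elim by linarith
  qed
qed

section \<open>Growth along rays\<close>

lemma poly_ray_limit:
  fixes P :: "complex poly"
  shows "((\<lambda>t. poly P (of_real t * cis \<theta>) / of_real (t ^ degree P)) \<longlongrightarrow>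
            lead_coeff P * cis (real (degree P) * \<theta>)) at_top"
proof -
  let ?n = "degree P"
  have "((\<lambda>t. \<Sum>i\<le>?n. coeff P i * cis \<theta> ^ i * of_real (t powr (real i - real ?n))) \<longlongrightarrow>
     (\<Sum>i\<le>?n. coeff P i * cis \<theta> ^ i * (if i = ?n then 1 else 0))) at_top"
  proof (intro tendsto_sum tendsto_mult tendsto_const)
    fix i assume i: "i \<in> {..?n}"
    show "((\<lambda>t. complex_of_real (t powr (real i - real ?n))) \<longlongrightarrow> (if i = ?n then 1 else 0)) at_top"
    proof (cases "i = ?n")
      case True
      have "((\<lambda>t::real. complex_of_real (t powr 0)) \<longlongrightarrow> 1) at_top"
        by (rule Lim_transform_eventually[OF tendsto_const])
           (use eventually_gt_at_top[of 0] in \<open>auto elim!: eventually_mono\<close>)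
      then show ?thesis using True by simp
    next
      case False
      then have "((\<lambda>t::real. t powr (real i - real ?n)) \<longlongrightarrow> 0) at_top"
        using i by (intro tendsto_neg_powr filterlim_ident) auto
      from tendsto_of_real[OF this, where 'a = complex] show ?thesis using False by simp
    qed
  qed
  also have "(\<Sum>i\<le>?n. coeff P i * cis \<theta> ^ i * (if i = ?n then 1 else 0)) = lead_coeff P * cis (real ?n * \<theta>)"
    by (simp add: if_distrib[of "\<lambda>x. _ * x"] sum.delta Complex.DeMoivre cong: if_cong)
  finally show ?thesis
  proof (rule Lim_transform_eventually)
    show "eventually (\<lambda>t. (\<Sum>i\<le>?n. coeff P i * cis \<theta> ^ i * of_real (t powr (real i - real ?n)))
        = poly P (of_real t * cis \<theta>) / of_real (t ^ ?n)) at_top"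
      using eventually_gt_at_top[of 0]
    proof eventually_elim
      case (elim t)
      have "complex_of_real (t powr (real i - real ?n)) = of_real t ^ i / of_real t ^ ?n" for i
        using elim by (simp add: powr_diff powr_realpow)
      then show ?case
        by (simp add: poly_altdef sum_divide_distrib power_mult_distrib mult_ac)
    qed
  qed
qed

lemma poly_ray_Re:
  fixes P :: "complex poly"
  assumes "lead_coeff P = of_real b * cis \<phi>" "b > 0"
  shows "cos (\<phi> + real (degree P) * \<theta>) > 0 \<Longrightarrow>
     \<exists>\<delta>>0. eventually (\<lambda>t. \<delta> * t ^ degree P \<le> Re (poly P (of_real t * cis \<theta>))) at_top"
    and "cos (\<phi> + real (degree P) * \<theta>) < 0 \<Longrightarrow>
     \<exists>\<delta>>0. eventually (\<lambda>t. Re (poly P (of_real t * cis \<theta>)) \<le> - \<delta> * t ^ degree P) at_top"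
proof -
  let ?n = "degree P" and ?c = "b * cos (\<phi> + real (degree P) * \<theta>)"
  have "((\<lambda>t. Re (poly P (of_real t * cis \<theta>) / of_real (t ^ ?n))) \<longlongrightarrow> Re (lead_coeff P * cis (real ?n * \<theta>))) at_top"
    by (intro tendsto_intros poly_ray_limit)
  moreover have "Re (lead_coeff P * cis (real ?n * \<theta>)) = ?c"
    unfolding assms(1) mult.assoc cis_mult by simp
  ultimately have lim: "((\<lambda>t. Re (poly P (of_real t * cis \<theta>)) / t ^ ?n) \<longlongrightarrow> ?c) at_top"
    unfolding Re_divide_of_real by simp
  {
    assume "cos (\<phi> + real ?n * \<theta>) > 0"
    then have c: "?c > 0" using assms by simp
    then have "?c / 2 < ?c" by linarith
    from order_tendstoD(1)[OF lim this]
    have "eventually (\<lambda>t. ?c / 2 * t ^ ?n \<le> Re (poly P (of_real t * cis \<theta>))) at_top"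
      using eventually_gt_at_top[of 0]
      by eventually_elim (simp add: less_divide_eq less_imp_le)
    moreover have "?c / 2 > 0" using c by linarith
    ultimately show "\<exists>\<delta>>0. eventually (\<lambda>t. \<delta> * t ^ ?n \<le> Re (poly P (of_real t * cis \<theta>))) at_top" by blast
  }
  {
    assume "cos (\<phi> + real ?n * \<theta>) < 0"
    then have c: "?c < 0" using assms by (simp add: mult_pos_neg)
    then have "?c < ?c / 2" by linarith
    from order_tendstoD(2)[OF lim this]
    have "eventually (\<lambda>t. Re (poly P (of_real t * cis \<theta>)) \<le> - (- ?c / 2) * t ^ ?n) at_top"
      using eventually_gt_at_top[of 0]
      by eventually_elim (simp add: divide_less_eq less_imp_le)
    moreover have "- ?c / 2 > 0" using c by linarith
    ultimately show "\<exists>\<delta>>0. eventually (\<lambda>t. Re (poly P (of_real t * cis \<theta>)) \<le> - \<delta> * t ^ ?n) at_top" by blast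
  }
qed

section \<open>Differential inequalities along a ray\<close>

lemma power_growth_from_derivative:
  fixes E E' :: "real \<Rightarrow> real"
  assumes T: "T > 0" and d: "\<And>t. t \<ge> T \<Longrightarrow> (E has_real_derivative E' t) (at t)"
    and le: "\<And>t. t \<ge> T \<Longrightarrow> E' t \<le> real k / t * E t" and t: "t \<ge> T"
  shows "E t \<le> E T / T ^ k * t ^ k"
proof -
  have "E t * t powr (- real k) \<le> E T * T powr (- real k)"
  proof (rule DERIV_nonpos_imp_nonincreasing[OF t])
    fix x assume x: "T \<le> x" "x \<le> t"
    have x0: "x > 0" using x T by linarith
    have "((\<lambda>t. E t * t powr (- real k)) has_real_derivative
        E' x * x powr (- real k) + (- real k * x powr (- real k - 1)) * E x) (at x)"
      by (rule DERIV_mult[OF d[OF x(1)] has_real_derivative_powr[OF x0]])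
    moreover have "E' x * x powr (- real k) + (- real k * x powr (- real k - 1)) * E x
       = (E' x - real k / x * E x) * x powr (- real k)"
      using x0 by (simp add: powr_diff algebra_simps)
    moreover have "\<dots> \<le> 0" using le[OF x(1)] by (intro mult_nonpos_nonneg) auto
    ultimately show "\<exists>y. ((\<lambda>t. E t * t powr (- real k)) has_real_derivative y) (at x) \<and> y \<le> 0" by metis
  qed
  moreover have "x powr (- real k) = 1 / x ^ k" if "x > 0" for x
    using that by (simp add: powr_minus powr_realpow divide_inverse)
  ultimately have "E t / t ^ k \<le> E T / T ^ k" using T t by simp
  then show ?thesis using T t by (simp add: pos_divide_le_eq)
qed

text \<open>The squared modulus is differentiable even at zeros of \<open>F\<close>, where the
  modulus itself may fail to be. Its derivative is 2 Re(cis \<theta> F' cnj F).\<close>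

lemma norm_sq_ray_derivative:
  fixes F :: "complex \<Rightarrow> complex"
  assumes "F holomorphic_on UNIV"
  obtains D where "\<And>t. ((\<lambda>t. (norm (F (of_real t * cis \<theta>)))\<^sup>2) has_real_derivative D t) (at t)"
    "\<And>t. D t \<le> 2 * norm (deriv F (of_real t * cis \<theta>)) * norm (F (of_real t * cis \<theta>))"
proof -
  let ?z = "\<lambda>t. of_real t * cis \<theta>"
  define D where "D t = 2 * Re (F (?z t)) * Re (cis \<theta> * deriv F (?z t)) + 2 * Im (F (?z t)) * Im (cis \<theta> * deriv F (?z t))" for t
  have v: "((\<lambda>t. F (?z t)) has_vector_derivative cis \<theta> * deriv F (?z t)) (at t)" for t
  proof -
    have "(F has_field_derivative deriv F (?z t)) (at (?z t))"
      using assms by (simp add: holomorphic_derivI)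
    moreover have "(?z has_vector_derivative cis \<theta>) (at t)"
      by (auto intro!: derivative_eq_intros)
    ultimately show ?thesis
      using field_vector_diff_chain_at[of ?z "cis \<theta>" t F] by (simp add: o_def)
  qed
  have re: "((\<lambda>t. Re (F (?z t))) has_real_derivative Re (cis \<theta> * deriv F (?z t))) (at t)" for t
    using bounded_linear.has_vector_derivative[OF bounded_linear_Re v]
    by (simp add: has_real_derivative_iff_has_vector_derivative)
  have im: "((\<lambda>t. Im (F (?z t))) has_real_derivative Im (cis \<theta> * deriv F (?z t))) (at t)" for t
    using bounded_linear.has_vector_derivative[OF bounded_linear_Im v]
    by (simp add: has_real_derivative_iff_has_vector_derivative)
  show ?thesis
  proof (rule that[of D])
    fix t
    show "((\<lambda>t. (norm (F (?z t)))\<^sup>2) has_real_derivative D t) (at t)"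
      unfolding cmod_power2 D_def by (rule derivative_eq_intros re im refl | simp)+
    have "D t = 2 * Re (cis \<theta> * deriv F (?z t) * cnj (F (?z t)))"
      by (simp add: D_def algebra_simps)
    also have "\<dots> \<le> 2 * norm (cis \<theta> * deriv F (?z t) * cnj (F (?z t)))"
      by (intro mult_left_mono complex_Re_le_cmod) simp
    also have "\<dots> = 2 * norm (deriv F (?z t)) * norm (F (?z t))"
      by (simp only: norm_mult norm_cis complex_mod_cnj mult_1_left mult.assoc)
    finally show "D t \<le> 2 * norm (deriv F (?z t)) * norm (F (?z t))" .
  qed
qed

lemma linear_growth_on_ray:
  fixes F :: "complex \<Rightarrow> complex"
  assumes F: "F holomorphic_on UNIV"
    and ev: "eventually (\<lambda>t. norm (deriv F (of_real t * cis \<theta>)) \<le> 1 / t * norm (F (of_real t * cis \<theta>))) at_top"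
  shows "\<exists>C. eventually (\<lambda>t. (norm (F (of_real t * cis \<theta>)))\<^sup>2 \<le> C * t ^ 2) at_top"
proof -
  let ?z = "\<lambda>t. of_real t * cis \<theta>"
  obtain D where D: "\<And>t. ((\<lambda>t. (norm (F (?z t)))\<^sup>2) has_real_derivative D t) (at t)"
    "\<And>t. D t \<le> 2 * norm (deriv F (?z t)) * norm (F (?z t))"
    using norm_sq_ray_derivative[OF F] by blast
  obtain T where T: "\<And>t. t \<ge> T \<Longrightarrow> norm (deriv F (?z t)) \<le> 1 / t * norm (F (?z t))"
    using ev unfolding eventually_at_top_linorder by blast
  define S where "S = max T 1"
  have "(norm (F (?z t)))\<^sup>2 \<le> (norm (F (?z S)))\<^sup>2 / S ^ 2 * t ^ 2" if "t \<ge> S" for t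
  proof (rule power_growth_from_derivative[OF _ D(1) _ that])
    show "S > 0" by (simp add: S_def)
    fix t assume t: "t \<ge> S"
    have "D t \<le> 2 * norm (deriv F (?z t)) * norm (F (?z t))" by (rule D(2))
    also have "\<dots> \<le> 2 * (1 / t * norm (F (?z t))) * norm (F (?z t))"
      using T[of t] t by (intro mult_left_mono mult_right_mono) (auto simp: S_def)
    finally show "D t \<le> real 2 / t * (norm (F (?z t)))\<^sup>2" by (simp add: power2_eq_square)
  qed
  then show ?thesis unfolding eventually_at_top_linorder by blast
qed

text \<open>This serves the rays where both coefficients are exponentially small. The equation then
  controls F'' rather than F'/F, so F' and F / t are estimated jointly; their energy grows at most
  like t^4, and undoing the division by t^2 gives t^6.\<close>

lemma cubic_growth_on_ray:
  fixes F :: "complex \<Rightarrow> complex"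
  assumes F: "F holomorphic_on UNIV"
    and ev: "eventually (\<lambda>t. norm (deriv (deriv F) (of_real t * cis \<theta>)) \<le>
        1 / t * norm (deriv F (of_real t * cis \<theta>)) + 1 / t\<^sup>2 * norm (F (of_real t * cis \<theta>))) at_top"
  shows "\<exists>C. eventually (\<lambda>t. (norm (F (of_real t * cis \<theta>)))\<^sup>2 \<le> C * t ^ 6) at_top"
proof -
  let ?z = "\<lambda>t. of_real t * cis \<theta>"
  have F': "deriv F holomorphic_on UNIV" using F by (simp add: holomorphic_deriv)
  obtain D where D: "\<And>t. ((\<lambda>t. (norm (F (?z t)))\<^sup>2) has_real_derivative D t) (at t)"
    "\<And>t. D t \<le> 2 * norm (deriv F (?z t)) * norm (F (?z t))"
    using norm_sq_ray_derivative[OF F] by blast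
  obtain D' where D': "\<And>t. ((\<lambda>t. (norm (deriv F (?z t)))\<^sup>2) has_real_derivative D' t) (at t)"
    "\<And>t. D' t \<le> 2 * norm (deriv (deriv F) (?z t)) * norm (deriv F (?z t))"
    using norm_sq_ray_derivative[OF F'] by blast
  obtain T where T: "\<And>t. t \<ge> T \<Longrightarrow> norm (deriv (deriv F) (?z t)) \<le> 1 / t * norm (deriv F (?z t)) + 1 / t\<^sup>2 * norm (F (?z t))"
    using ev unfolding eventually_at_top_linorder by blast
  define S where "S = max T 1"
  txt \<open>The weight \<open>1 / t\<^sup>2\<close> balances the two terms: it makes the coefficient in \<open>E' \<le> (4 / t) E\<close>
    decay like \<open>1 / t\<close>, which gives polynomial instead of exponential growth.\<close>
  define E where "E t = (norm (deriv F (?z t)))\<^sup>2 + (norm (F (?z t)))\<^sup>2 / t\<^sup>2" for t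
  define E' where "E' t = D' t + (D t * t\<^sup>2 - (norm (F (?z t)))\<^sup>2 * (2 * t)) / (t\<^sup>2 * t\<^sup>2)" for t
  have EE: "E t \<le> E S / S ^ 4 * t ^ 4" if "t \<ge> S" for t
  proof (rule power_growth_from_derivative[where E' = E'])
    show "S > 0" by (simp add: S_def)
    fix t assume t: "t \<ge> S"
    have t0: "t > 0" using t by (simp add: S_def)
    show "(E has_real_derivative E' t) (at t)"
      unfolding E_def E'_def
      by (rule derivative_eq_intros D D' refl | (use t0 in simp))+
    define x where "x = norm (deriv F (?z t))"
    define y where "y = norm (F (?z t)) / t"
    have y: "norm (F (?z t)) = y * t" using t0 by (simp add: y_def)
    have xy: "x \<ge> 0" "y \<ge> 0" using t0 by (auto simp: x_def y_def)
    have "norm (deriv (deriv F) (?z t)) \<le> 1 / t * x + 1 / t\<^sup>2 * (y * t)"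
      using T[of t] t unfolding x_def y[symmetric] by (simp add: S_def)
    also have "\<dots> = (x + y) / t" using t0 by (simp add: power2_eq_square add_divide_distrib)
    finally have "D' t \<le> 2 * ((x + y) / t) * x"
      using D'(2)[of t] xy mult_right_mono[of "2 * norm (deriv (deriv F) (?z t))" "2 * ((x + y) / t)" x]
      unfolding x_def by linarith
    moreover have "(D t * t\<^sup>2 - (norm (F (?z t)))\<^sup>2 * (2 * t)) / (t\<^sup>2 * t\<^sup>2) \<le> 2 * x * y / t"
    proof -
      have "D t * t\<^sup>2 - (norm (F (?z t)))\<^sup>2 * (2 * t) \<le> D t * t\<^sup>2" using t0 by simp
      also have "\<dots> \<le> (2 * x * (y * t)) * t\<^sup>2"
        using D(2)[of t] unfolding x_def y by (intro mult_right_mono) auto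
      finally have "(D t * t\<^sup>2 - (norm (F (?z t)))\<^sup>2 * (2 * t)) / (t\<^sup>2 * t\<^sup>2) \<le> (2 * x * (y * t)) * t\<^sup>2 / (t\<^sup>2 * t\<^sup>2)"
        by (intro divide_right_mono) auto
      also have "\<dots> = 2 * x * y / t" using t0 by (simp add: power2_eq_square)
      finally show ?thesis .
    qed
    ultimately have "E' t \<le> 2 * ((x + y) / t) * x + 2 * x * y / t" unfolding E'_def by linarith
    also have "\<dots> = (2 * x\<^sup>2 + 4 * x * y) / t" by (simp add: add_divide_distrib power2_eq_square algebra_simps)
    also have "\<dots> \<le> (4 * (x\<^sup>2 + y\<^sup>2)) / t"
    proof (rule divide_right_mono)
      have "0 \<le> 2 * (x - y)\<^sup>2 + 2 * y\<^sup>2" by simp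
      then show "2 * x\<^sup>2 + 4 * x * y \<le> 4 * (x\<^sup>2 + y\<^sup>2)" by (simp add: power2_eq_square algebra_simps)
    qed (use t0 in simp)
    finally show "E' t \<le> real 4 / t * E t"
      by (simp add: E_def x_def y_def power_divide)
  qed (rule that)
  have "(norm (F (?z t)))\<^sup>2 \<le> E S / S ^ 4 * t ^ 6" if "t \<ge> S" for t
  proof -
    have t0: "t > 0" using that by (simp add: S_def)
    have "(norm (F (?z t)))\<^sup>2 / t\<^sup>2 \<le> E t" by (simp add: E_def)
    also have "\<dots> \<le> E S / S ^ 4 * t ^ 4" using EE that .
    finally have "(norm (F (?z t)))\<^sup>2 \<le> E S / S ^ 4 * t ^ 4 * t\<^sup>2" using t0 by (simp add: pos_divide_le_eq)
    also have "\<dots> = E S / S ^ 4 * (t ^ 4 * t ^ 2)" by (simp only: mult.assoc)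
    also have "t ^ 4 * t ^ 2 = t ^ 6" by (simp add: power_add[symmetric])
    finally show ?thesis .
  qed
  then show ?thesis unfolding eventually_at_top_linorder by blast
qed

lemma power_le_exp_powr:
  fixes t s :: real
  assumes "t \<ge> 1" "s > 0"
  shows "t ^ p \<le> exp (real p / s * t powr s)"
proof -
  have "ln t \<le> t powr s / s" by (rule ln_powr_bound) (use assms in auto)
  then have "real p * ln t \<le> real p / s * t powr s"
    using mult_left_mono[of "ln t" "t powr s / s" "real p"] by simp
  then have "exp (real p * ln t) \<le> exp (real p / s * t powr s)" by simp
  then show ?thesis using assms by (simp add: exp_of_nat_mult)
qed

lemma ray_growth_of_power_bound:
  assumes gr: "exp_growth \<tau> F" and par: "0 < \<tau>" "0 < s"
    and ev: "eventually (\<lambda>t. (norm (F (of_real t * cis \<theta>)))\<^sup>2 \<le> C * t ^ k) at_top"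
  shows "ray_growth s F \<theta>"
proof (rule ray_growthI_eventually[OF gr par])
  define B where "B = 1 + \<bar>C\<bar> + real k / s"
  show "B \<ge> 0" using par by (simp add: B_def)
  show "eventually (\<lambda>t. norm (F (of_real t * cis \<theta>)) \<le> exp (B * (1 + t powr s))) at_top"
    using ev eventually_ge_at_top[of 1]
  proof eventually_elim
    case (elim t)
    let ?x = "norm (F (of_real t * cis \<theta>))"
    have "?x \<le> 1 + ?x\<^sup>2" using zero_le_power2[of "?x - 1/2"] by (simp add: power2_eq_square algebra_simps) 
    also have "\<dots> \<le> 1 + \<bar>C\<bar> * t ^ k"
    proof -
      have "C * t ^ k \<le> \<bar>C\<bar> * t ^ k" using elim by (intro mult_right_mono) auto
      then show ?thesis using elim by linarith
    qed
    also have "\<dots> \<le> (1 + \<bar>C\<bar>) * t ^ k" using elim by (simp add: algebra_simps one_le_power)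
    also have "\<dots> \<le> exp (1 + \<bar>C\<bar>) * exp (real k / s * t powr s)"
    proof (rule mult_mono)
      show "1 + \<bar>C\<bar> \<le> exp (1 + \<bar>C\<bar>)" using exp_ge_add_one_self[of "1 + \<bar>C\<bar>"] by linarith
      show "t ^ k \<le> exp (real k / s * t powr s)" using elim(2) par(2) by (rule power_le_exp_powr)
    qed (use elim in auto)
    also have "\<dots> = exp (1 + \<bar>C\<bar> + real k / s * t powr s)" by (simp only: exp_add)
    also have "\<dots> \<le> exp (B * (1 + t powr s))"
    proof -
      have "B * (1 + t powr s) = (1 + \<bar>C\<bar>) + real k / s * t powr s + (1 + \<bar>C\<bar>) * t powr s + real k / s"
        by (simp only: B_def algebra_simps)
      moreover have "(1 + \<bar>C\<bar>) * t powr s \<ge> 0" "real k / s \<ge> 0" using par by auto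
      ultimately show ?thesis unfolding exp_le_cancel_iff by linarith
    qed
    finally show ?case .
  qed
qed

section \<open>Directions in which a cosine is positive or nonzero\<close>

lemma cos_pos_both_sides:
  fixes \<psi> e :: real
  assumes "e > 0"
  obtains a b where "a < \<psi>" "\<psi> < b" "b - a < pi + e" "cos a > 0" "cos b > 0"
proof -
  \<comment> \<open>Reduction modulo 2 pi to (-pi/2, 3 pi/2]: on the first half of this range the
    cosine is positive, and the second half is a single gap of length pi where it is at most
    0.\<close>
  define k where "k = \<lceil>(\<psi> - 3 * pi / 2) / (2 * pi)\<rceil>"
  define x where "x = \<psi> - 2 * pi * of_int k"
  have "(\<psi> - 3 * pi / 2) / (2 * pi) \<le> of_int k" "of_int k < (\<psi> - 3 * pi / 2) / (2 * pi) + 1"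
    unfolding k_def by linarith+
  then have x: "x \<le> 3 * pi / 2" "- pi / 2 < x"
    by (auto simp: x_def field_simps)
  have cs: "cos (y + 2 * pi * of_int k) = cos y" for y
    using cos_add[of y "2 * pi * of_int k"] by (simp add: cos_int_2pin sin_int_2pin)
  have \<psi>: "\<psi> = x + 2 * pi * of_int k" by (simp add: x_def)
  show ?thesis
  proof (cases "x < pi / 2")
    case True
    define d where "d = min 1 (min (pi / 2 - x) (x + pi / 2)) / 2"
    have d: "d > 0" "d < pi / 2 - x" "d < x + pi / 2" "d \<le> 1/2" using True x by (auto simp: d_def min_def field_simps)
    have "cos (x - d) > 0" "cos (x + d) > 0" using d by (auto intro!: cos_gt_zero_pi)
    then show ?thesis using that[of "\<psi> - d" "\<psi> + d"] d assms pi_gt3 cs[of "x - d"] cs[of "x + d"]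
      by (simp add: \<psi> algebra_simps)
  next
    case False
    \<comment> \<open>Stepping \<open>d\<close> beyond both ends of the gap [pi/2, 3 pi/2] gives an
      opening of pi + 2 d < pi + e.\<close>
    define d where "d = min 1 e / 3"
    have d: "d > 0" "2 * d < e" "d < pi" using assms pi_gt3 by (auto simp: d_def min_def)
    have s: "sin d > 0" using d by (intro sin_gt_zero) auto
    have 1: "cos (pi / 2 - d) > 0" using s by (simp add: cos_diff)
    have "cos (3 * pi / 2 + d) = cos (pi + (pi / 2 + d))" by (simp add: algebra_simps)
    also have "\<dots> = sin d" by (simp only: cos_add) (simp add: cos_add sin_add)
    finally have 2: "cos (3 * pi / 2 + d) > 0" using s by simp
    show ?thesis
    proof (rule that[of "pi / 2 - d + 2 * pi * of_int k" "3 * pi / 2 + d + 2 * pi * of_int k"])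
      show "cos (pi / 2 - d + 2 * pi * of_int k) > 0" "cos (3 * pi / 2 + d + 2 * pi * of_int k) > 0"
        unfolding cs using 1 2 by simp_all
    qed (use d False x \<psi> in linarith)+
  qed
qed

text \<open>Zeros of the cosine differ by multiples of pi, so of two points whose phases differ by
  an amount strictly between 0 and pi at least one is suitable.\<close>

lemma cos_affine_nonzero_dense:
  fixes \<phi> m a b :: real
  assumes "a < b" "m > 0"
  obtains x where "a < x" "x < b" "cos (\<phi> + m * x) \<noteq> 0"
proof -
  define d where "d = min (b - a) (pi / m) / 3"
  have d0: "d > 0" using assms by (simp add: d_def)
  have d1: "3 * d \<le> b - a" "3 * d \<le> pi / m" unfolding d_def by simp_all
  have "m * (3 * d) \<le> m * (pi / m)" using assms d1 by (intro mult_left_mono) auto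
  moreover have "m * d > 0" using assms d0 by simp
  ultimately have "m * d < pi" using assms by simp
  then have d: "d > 0" "2 * d < b - a" "m * d < pi" using d0 d1 by linarith+
  have "sin (m * d) > 0" using d assms by (intro sin_gt_zero) auto
  moreover have "sin (m * d) = sin ((\<phi> + m * (a + 2 * d)) - (\<phi> + m * (a + d)))" by (simp add: algebra_simps)
  ultimately have "cos (\<phi> + m * (a + 2 * d)) \<noteq> 0 \<or> cos (\<phi> + m * (a + d)) \<noteq> 0"
    unfolding sin_diff by auto
  then show ?thesis using that[of "a + d"] that[of "a + 2 * d"] d by auto
qed

text \<open>Having a given nonzero sign is an open condition, so a direction of that sign can be
  moved slightly onto a ray that avoids the zeros.\<close>

lemma dense_in_open_sign:
  fixes g :: "real \<Rightarrow> real"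
  assumes g: "\<And>x. isCont g x" and dense: "\<And>x y. x < y \<Longrightarrow> \<exists>\<theta>. x < \<theta> \<and> \<theta> < y \<and> Q \<theta>"
    and x: "g x \<noteq> 0" and ab: "a < x" "x < b"
  obtains \<theta> where "a < \<theta>" "\<theta> < b" "Q \<theta>" "sgn (g \<theta>) = sgn (g x)"
proof -
  have "eventually (\<lambda>y. g y * g x > 0) (nhds x)"
  proof (rule order_tendstoD(1))
    show "((\<lambda>y. g y * g x) \<longlongrightarrow> g x * g x) (nhds x)"
      using g[of x] by (intro tendsto_intros) (simp add: continuous_within tendsto_nhds_iff isCont_def)
    show "0 < g x * g x" using x by (simp add: zero_less_mult_iff) linarith
  qed
  then obtain e where e: "e > 0" "\<And>y. dist y x < e \<Longrightarrow> g y * g x > 0"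
    unfolding eventually_nhds_metric by blast
  have "x < min b (x + e)" using e ab by simp
  then obtain \<theta> where \<theta>: "x < \<theta>" "\<theta> < min b (x + e)" "Q \<theta>" using dense by blast
  then have "g \<theta> * g x > 0" using e(2)[of \<theta>] by (simp add: dist_real_def)
  then have "sgn (g \<theta>) = sgn (g x)" by (auto simp: sgn_if zero_less_mult_iff)
  then show ?thesis using that[of \<theta>] \<theta> ab by simp
qed

section \<open>The differential equation on a ray\<close>

text \<open>Since f''/f = (f''/f')(f'/f), the zeros of f' have to be avoided as well. The lower
  bound for \<open>f\<close> supplies f \<noteq> 0 on the ray.\<close>

lemma logarithmic_derivatives_on_ray:
  fixes f :: "complex \<Rightarrow> complex"
  assumes f: "f holomorphic_on UNIV" "\<exists>z. deriv f z \<noteq> 0" "\<tau> > 0" "exp_growth \<tau> f"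
    and av: "avoids Z N \<theta>" "\<And>a. f a = 0 \<Longrightarrow> a \<in> Z" "\<And>a. deriv f a = 0 \<Longrightarrow> a \<in> Z"
  obtains p where "eventually (\<lambda>t. f (of_real t * cis \<theta>) \<noteq> 0 \<and>
      norm (deriv f (of_real t * cis \<theta>)) \<le> t ^ p * norm (f (of_real t * cis \<theta>)) \<and>
      norm (deriv (deriv f) (of_real t * cis \<theta>)) \<le> t ^ p * norm (f (of_real t * cis \<theta>))) at_top"
proof -
  have nz: "\<exists>z. f z \<noteq> 0"
  proof (rule ccontr)
    assume "\<not> ?thesis"
    then have "f = (\<lambda>z. 0)" by auto
    then show False using f(2) by simp
  qed
  have f': "deriv f holomorphic_on UNIV" "exp_growth \<tau> (deriv f)"
    using f by (auto simp: holomorphic_deriv exp_growth_deriv)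
  obtain p where p: "eventually (\<lambda>t. norm (deriv f (of_real t * cis \<theta>)) \<le> t ^ p * norm (f (of_real t * cis \<theta>))) at_top"
    using ray_estimates(1)[OF f(1) nz f(3,4) av(1,2)] by blast
  obtain q where q: "eventually (\<lambda>t. norm (deriv (deriv f) (of_real t * cis \<theta>)) \<le> t ^ q * norm (deriv f (of_real t * cis \<theta>))) at_top"
    using ray_estimates(1)[OF f'(1) f(2,3) f'(2) av(1,3)] by blast
  have l: "eventually (\<lambda>t. exp (- (t powr (\<tau> + 1))) \<le> norm (f (of_real t * cis \<theta>))) at_top"
    by (rule ray_estimates(2)[OF f(1) nz f(3,4) av(1,2)]) auto
  have "eventually (\<lambda>t. f (of_real t * cis \<theta>) \<noteq> 0 \<and>
      norm (deriv f (of_real t * cis \<theta>)) \<le> t ^ (p + q) * norm (f (of_real t * cis \<theta>)) \<and>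
      norm (deriv (deriv f) (of_real t * cis \<theta>)) \<le> t ^ (p + q) * norm (f (of_real t * cis \<theta>))) at_top"
    using p q l eventually_ge_at_top[of 1]
  proof eventually_elim
    case (elim t)
    let ?z = "of_real t * cis \<theta>"
    have "norm (f ?z) > 0" using elim(3) exp_gt_zero less_le_trans by blast
    then have "f ?z \<noteq> 0" by simp
    moreover have "norm (deriv f ?z) \<le> t ^ (p + q) * norm (f ?z)"
      using elim(4) by (intro order_trans[OF elim(1)] mult_right_mono power_increasing) auto
    moreover have "norm (deriv (deriv f) ?z) \<le> t ^ q * (t ^ p * norm (f ?z))"
      using elim(1,4) by (intro order_trans[OF elim(2)] mult_left_mono) auto
    ultimately show ?case by (simp add: power_add mult_ac)
  qed
  then show ?thesis by (rule that)
qed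

text \<open>Division by exp(Q) f leaves exp(-Q) in front of f''/f, which is where the sign of Re Q
  enters; in front of h1 f'/f the exponentials cancel up to the constant exp k, so the growth of
  \<open>h1\<close> carries over to \<open>h0\<close>.\<close>

lemma coefficient_growth_equal_exponents:
  fixes f h1 h0 Q :: "complex \<Rightarrow> complex"
  assumes gr: "exp_growth s h1" "0 < s" "exp_growth s0 h0" "0 < s0"
    and eq: "\<And>z. deriv (deriv f) z + h1 z * exp (Q z + k) * deriv f z + h0 z * exp (Q z) * f z = 0"
    and Q: "eventually (\<lambda>t. 0 \<le> Re (Q (of_real t * cis \<theta>))) at_top"
    and ld: "eventually (\<lambda>t. f (of_real t * cis \<theta>) \<noteq> 0 \<and>
      norm (deriv f (of_real t * cis \<theta>)) \<le> t ^ p * norm (f (of_real t * cis \<theta>)) \<and>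
      norm (deriv (deriv f) (of_real t * cis \<theta>)) \<le> t ^ p * norm (f (of_real t * cis \<theta>))) at_top"
  shows "ray_growth s h0 \<theta>"
proof -
  obtain K where K: "K \<ge> 0" "\<And>z. norm (h1 z) \<le> exp (K * (1 + norm z powr s))"
    using gr(1) unfolding exp_growth_def by blast
  define B where "B = 1 + K + \<bar>Re k\<bar> + real p / s"
  show ?thesis
  proof (rule ray_growthI_eventually[OF gr(3,4,2)])
    show "B \<ge> 0" using K gr(2) by (simp add: B_def)
    show "eventually (\<lambda>t. norm (h0 (of_real t * cis \<theta>)) \<le> exp (B * (1 + t powr s))) at_top"
      using Q ld eventually_ge_at_top[of 1]
    proof eventually_elim
      case (elim t)
      let ?z = "of_real t * cis \<theta>"
      define x where "x = exp (K * (1 + t powr s) + \<bar>Re k\<bar> + real p / s * t powr s)"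
      have tp: "t ^ p \<le> exp (real p / s * t powr s)" using elim gr(2) by (intro power_le_exp_powr) auto
      have nz: "norm ?z = t" using elim by (simp add: norm_mult)
      have e1: "exp (- Q ?z) * exp (Q ?z) = 1" by (simp add: exp_minus)
      have "h0 ?z * f ?z = exp (- Q ?z) * (h0 ?z * exp (Q ?z) * f ?z)"
        using e1 by (simp add: mult_ac)
      also have "h0 ?z * exp (Q ?z) * f ?z = - (deriv (deriv f) ?z + h1 ?z * exp (Q ?z + k) * deriv f ?z)"
        using eq[of ?z] by (simp add: add_eq_0_iff)
      also have "exp (- Q ?z) * \<dots> = - (exp (- Q ?z) * deriv (deriv f) ?z + h1 ?z * exp k * deriv f ?z)"
        using e1 by (simp add: exp_add algebra_simps)
      finally have "norm (h0 ?z) * norm (f ?z) = norm (exp (- Q ?z) * deriv (deriv f) ?z + h1 ?z * exp k * deriv f ?z)"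
        by (metis norm_minus_cancel norm_mult)
      also have "\<dots> \<le> norm (exp (- Q ?z) * deriv (deriv f) ?z) + norm (h1 ?z * exp k * deriv f ?z)"
        by (rule norm_triangle_ineq)
      also have "norm (exp (- Q ?z) * deriv (deriv f) ?z) \<le> x * norm (f ?z)"
      proof -
        have "norm (exp (- Q ?z) * deriv (deriv f) ?z) \<le> 1 * (t ^ p * norm (f ?z))"
          unfolding norm_mult using elim by (intro mult_mono) auto
        also have "t ^ p \<le> x"
          unfolding x_def using K by (intro order_trans[OF tp]) (auto intro!: add_nonneg_nonneg mult_nonneg_nonneg)
        finally show ?thesis by (simp add: mult_right_mono)
      qed
      also have "norm (h1 ?z * exp k * deriv f ?z) \<le> x * norm (f ?z)"
      proof -
        have "norm (h1 ?z * exp k * deriv f ?z) \<le> exp (K * (1 + t powr s)) * exp \<bar>Re k\<bar> * (t ^ p * norm (f ?z))"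
          unfolding norm_mult using K(2)[of ?z] elim nz by (intro mult_mono) auto
        also have "\<dots> \<le> exp (K * (1 + t powr s)) * exp \<bar>Re k\<bar> * (exp (real p / s * t powr s) * norm (f ?z))"
          using tp by (intro mult_left_mono mult_right_mono) auto
        also have "\<dots> = x * norm (f ?z)" by (simp add: x_def exp_add mult_ac)
        finally show ?thesis .
      qed
      finally have "norm (h0 ?z) * norm (f ?z) \<le> (2 * x) * norm (f ?z)" by simp
      then have "norm (h0 ?z) \<le> 2 * x" using elim(2) by (simp only: mult_le_cancel_right) auto
      also have "\<dots> \<le> exp 1 * x" using exp_ge_add_one_self[of 1] by (intro mult_right_mono) (auto simp: x_def)
      also have "\<dots> = exp (1 + (K * (1 + t powr s) + \<bar>Re k\<bar> + real p / s * t powr s))" by (simp only: x_def exp_add)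
      also have "\<dots> \<le> exp (B * (1 + t powr s))"
      proof -
        have "B * (1 + t powr s) = 1 + (K * (1 + t powr s) + \<bar>Re k\<bar> + real p / s * t powr s)
             + (t powr s + \<bar>Re k\<bar> * t powr s + real p / s)" by (simp only: B_def algebra_simps)
        moreover have "0 \<le> t powr s + \<bar>Re k\<bar> * t powr s + real p / s" using gr(2) by simp
        ultimately show ?thesis unfolding exp_le_cancel_iff by linarith
      qed
      finally show ?case .
    qed
  qed
qed

text \<open>Division by exp(cQ + k) leaves exp(-cQ) with f'' and exp(-(c-1)Q) with h0 f; the second
  decays more slowly and sets the rate. \<open>h1\<close> stays on the left because the product h1
  f' is compared as a whole with its lower bound in the final contradiction.\<close>

lemma exponential_decay_on_ray:
  fixes f h1 h0 Q :: "complex \<Rightarrow> complex" and n :: nat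
  assumes h0: "eventually (\<lambda>t. norm (h0 (of_real t * cis \<theta>)) \<le> exp (t powr \<sigma>)) at_top"
    and \<sigma>: "0 < \<sigma>" "\<sigma> < real n" and c: "c > 1" and \<delta>: "\<delta> > 0"
    and eq: "\<And>z. deriv (deriv f) z + h1 z * exp (of_real c * Q z + k) * deriv f z + h0 z * exp (Q z) * f z = 0"
    and Q: "eventually (\<lambda>t. \<delta> * t ^ n \<le> Re (Q (of_real t * cis \<theta>))) at_top"
    and ld: "eventually (\<lambda>t. f (of_real t * cis \<theta>) \<noteq> 0 \<and>
      norm (deriv f (of_real t * cis \<theta>)) \<le> t ^ p * norm (f (of_real t * cis \<theta>)) \<and>
      norm (deriv (deriv f) (of_real t * cis \<theta>)) \<le> t ^ p * norm (f (of_real t * cis \<theta>))) at_top"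
  obtains \<eta> where "\<eta> > 0"
    "eventually (\<lambda>t. norm (h1 (of_real t * cis \<theta>)) * norm (deriv f (of_real t * cis \<theta>))
        \<le> exp (- \<eta> * t powr n) * norm (f (of_real t * cis \<theta>))) at_top"
proof -
  \<comment> \<open>Half of the rate (c - 1) \<delta> is given up to absorb exp(t^\<sigma>), the
    power t^p and the constants.\<close>
  define \<eta> where "\<eta> = (c - 1) * \<delta> / 2"
  have \<eta>: "\<eta> > 0" using c \<delta> by (simp add: \<eta>_def)
  have "eventually (\<lambda>t. (1 + \<bar>Re k\<bar>) + (1 + real p / \<sigma>) * t powr \<sigma> \<le> \<eta> * t powr n) at_top"
    by (rule eventually_powr_dominated) (use \<sigma> \<eta> in auto)
  then have "eventually (\<lambda>t. norm (h1 (of_real t * cis \<theta>)) * norm (deriv f (of_real t * cis \<theta>))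
        \<le> exp (- \<eta> * t powr n) * norm (f (of_real t * cis \<theta>))) at_top"
    using h0 Q ld eventually_ge_at_top[of 1]
  proof eventually_elim
    case (elim t)
    let ?z = "of_real t * cis \<theta>"
    define q where "q = Re (Q ?z)"
    define x where "x = exp (\<bar>Re k\<bar> + (1 + real p / \<sigma>) * t powr \<sigma> - (c - 1) * q)"
    have tn: "t powr n = t ^ n" using elim by (simp add: powr_realpow)
    have q: "\<delta> * t ^ n \<le> q" "q \<ge> 0"
    proof -
      show "\<delta> * t ^ n \<le> q" using elim by (simp add: q_def)
      moreover have "0 \<le> \<delta> * t ^ n" using \<delta> elim by simp
      ultimately show "q \<ge> 0" by linarith
    qed
    have tp: "t ^ p \<le> exp (real p / \<sigma> * t powr \<sigma>)" using elim \<sigma> by (intro power_le_exp_powr) auto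
    define E where "E = of_real c * Q ?z + k"
    have e1: "exp (- E) * exp E = 1" by (simp add: exp_minus)
    have e2: "exp (- E) * exp (Q ?z) = exp (- (of_real (c - 1) * Q ?z) - k)"
      by (simp add: E_def exp_add[symmetric] algebra_simps)
    have "h1 ?z * deriv f ?z = exp (- E) * (h1 ?z * exp E * deriv f ?z)"
      using e1 by (simp add: mult_ac)
    also have "h1 ?z * exp E * deriv f ?z = - (deriv (deriv f) ?z + h0 ?z * exp (Q ?z) * f ?z)"
      using eq[of ?z, folded E_def] by algebra
    also have "exp (- E) * \<dots> = - (exp (- E) * deriv (deriv f) ?z + h0 ?z * (exp (- E) * exp (Q ?z)) * f ?z)"
      by (simp add: algebra_simps)
    finally have "h1 ?z * deriv f ?z = - (exp (- E) * deriv (deriv f) ?z + h0 ?z * exp (- (of_real (c - 1) * Q ?z) - k) * f ?z)"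
      unfolding e2 .
    then have "norm (h1 ?z) * norm (deriv f ?z) = norm (exp (- E) * deriv (deriv f) ?z + h0 ?z * exp (- (of_real (c - 1) * Q ?z) - k) * f ?z)"
      by (metis norm_minus_cancel norm_mult)
    also have "\<dots> \<le> norm (exp (- E) * deriv (deriv f) ?z) + norm (h0 ?z * exp (- (of_real (c - 1) * Q ?z) - k) * f ?z)"
      by (rule norm_triangle_ineq)
    also have "norm (exp (- E) * deriv (deriv f) ?z) \<le> x * norm (f ?z)"
    proof -
      have "norm (exp (- E) * deriv (deriv f) ?z) = exp (- (c * q) - Re k) * norm (deriv (deriv f) ?z)"
        by (simp add: E_def norm_mult q_def)
      also have "\<dots> \<le> exp (- (c * q) - Re k) * (exp (real p / \<sigma> * t powr \<sigma>) * norm (f ?z))"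
      proof (rule mult_left_mono)
        have "norm (deriv (deriv f) ?z) \<le> t ^ p * norm (f ?z)" using elim by blast
        also have "\<dots> \<le> exp (real p / \<sigma> * t powr \<sigma>) * norm (f ?z)" using tp by (rule mult_right_mono) simp
        finally show "norm (deriv (deriv f) ?z) \<le> exp (real p / \<sigma> * t powr \<sigma>) * norm (f ?z)" .
      qed simp
      also have "\<dots> = exp (- (c * q) - Re k + real p / \<sigma> * t powr \<sigma>) * norm (f ?z)" by (simp add: exp_add)
      also have "\<dots> \<le> x * norm (f ?z)"
        unfolding x_def
      proof (intro mult_right_mono)
        have "t powr \<sigma> \<ge> 0" "(1 + real p / \<sigma>) * t powr \<sigma> = t powr \<sigma> + real p / \<sigma> * t powr \<sigma>"
          "(c - 1) * q = c * q - q" by (auto simp: algebra_simps)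
        then show "exp (- (c * q) - Re k + real p / \<sigma> * t powr \<sigma>) \<le> exp (\<bar>Re k\<bar> + (1 + real p / \<sigma>) * t powr \<sigma> - (c - 1) * q)"
          using q(2) unfolding exp_le_cancel_iff by linarith
      qed simp
      finally show ?thesis .
    qed
    also have "norm (h0 ?z * exp (- (of_real (c - 1) * Q ?z) - k) * f ?z) \<le> x * norm (f ?z)"
    proof -
      have "norm (h0 ?z * exp (- (of_real (c - 1) * Q ?z) - k) * f ?z) = norm (h0 ?z) * exp (- ((c - 1) * q) - Re k) * norm (f ?z)"
        by (simp add: norm_mult q_def)
      also have "\<dots> \<le> exp (t powr \<sigma>) * exp (- ((c - 1) * q) - Re k) * norm (f ?z)"
        using elim by (intro mult_right_mono) auto
      also have "\<dots> = exp (t powr \<sigma> + (- ((c - 1) * q) - Re k)) * norm (f ?z)" by (simp only: exp_add)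
      also have "\<dots> \<le> x * norm (f ?z)"
        unfolding x_def
      proof (intro mult_right_mono)
        have "real p / \<sigma> * t powr \<sigma> \<ge> 0" "(1 + real p / \<sigma>) * t powr \<sigma> = t powr \<sigma> + real p / \<sigma> * t powr \<sigma>"
          using \<sigma> by (auto simp: algebra_simps)
        then show "exp (t powr \<sigma> + (- ((c - 1) * q) - Re k)) \<le> exp (\<bar>Re k\<bar> + (1 + real p / \<sigma>) * t powr \<sigma> - (c - 1) * q)"
          unfolding exp_le_cancel_iff by linarith
      qed simp
      finally show ?thesis .
    qed
    finally have "norm (h1 ?z) * norm (deriv f ?z) \<le> (2 * x) * norm (f ?z)" by simp
    also have "\<dots> \<le> exp (- \<eta> * t powr n) * norm (f ?z)"
    proof (rule mult_right_mono)
      have "2 * x \<le> exp 1 * x" using exp_ge_add_one_self[of 1] by (intro mult_right_mono) (auto simp: x_def)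
      also have "\<dots> = exp (1 + (\<bar>Re k\<bar> + (1 + real p / \<sigma>) * t powr \<sigma> - (c - 1) * q))" by (simp only: x_def exp_add)
      also have "\<dots> \<le> exp (- \<eta> * t powr n)"
      proof -
        have "(c - 1) * (\<delta> * t ^ n) \<le> (c - 1) * q" using q c by (intro mult_left_mono) auto
        moreover have "(c - 1) * (\<delta> * t ^ n) = 2 * (\<eta> * t powr n)" by (simp add: \<eta>_def tn)
        ultimately show ?thesis using elim(1) unfolding exp_le_cancel_iff by linarith
      qed
      finally show "2 * x \<le> exp (- \<eta> * t powr n)" .
    qed simp
    finally show ?case .
  qed
  then show ?thesis using that \<eta> by blast
qed

text \<open>As \<sigma> < n, dividing by \<open>h1\<close> costs less than the decay provides, and
  what remains is below 1/t.\<close>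

lemma ray_growth_right:
  fixes f h1 :: "complex \<Rightarrow> complex" and n :: nat
  assumes f: "f holomorphic_on UNIV" "exp_growth \<tau> f" "\<tau> > 0" and s: "s > 0"
    and h1: "eventually (\<lambda>t. exp (- (t powr \<sigma>)) \<le> norm (h1 (of_real t * cis \<theta>))) at_top"
    and \<sigma>: "0 < \<sigma>" "\<sigma> < real n" and \<eta>: "\<eta> > 0"
    and dec: "eventually (\<lambda>t. norm (h1 (of_real t * cis \<theta>)) * norm (deriv f (of_real t * cis \<theta>))
        \<le> exp (- \<eta> * t powr n) * norm (f (of_real t * cis \<theta>))) at_top"
  shows "ray_growth s f \<theta>"
proof -
  have "eventually (\<lambda>t. 0 + (1 + 1 / \<sigma>) * t powr \<sigma> \<le> \<eta> * t powr n) at_top"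
    by (rule eventually_powr_dominated) (use \<sigma> \<eta> in auto)
  then have "eventually (\<lambda>t. norm (deriv f (of_real t * cis \<theta>)) \<le> 1 / t * norm (f (of_real t * cis \<theta>))) at_top"
    using h1 dec eventually_ge_at_top[of 1]
  proof eventually_elim
    case (elim t)
    let ?z = "of_real t * cis \<theta>"
    have "exp (- (t powr \<sigma>)) * norm (deriv f ?z) \<le> norm (h1 ?z) * norm (deriv f ?z)"
      using elim by (intro mult_right_mono) auto
    also have "\<dots> \<le> exp (- \<eta> * t powr n) * norm (f ?z)" using elim by blast
    finally have "exp (t powr \<sigma>) * (exp (- (t powr \<sigma>)) * norm (deriv f ?z)) \<le> exp (t powr \<sigma>) * (exp (- \<eta> * t powr n) * norm (f ?z))"
      by (intro mult_left_mono) auto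
    moreover have "exp (t powr \<sigma>) * exp (- (t powr \<sigma>)) = 1" by (simp add: exp_minus)
    ultimately have "norm (deriv f ?z) \<le> exp (t powr \<sigma>) * exp (- \<eta> * t powr n) * norm (f ?z)"
      by (simp add: mult.assoc[symmetric])
    also have "\<dots> \<le> 1 / t * norm (f ?z)"
    proof (rule mult_right_mono)
      have l: "ln t \<le> t powr \<sigma> / \<sigma>" by (rule ln_powr_bound) (use elim \<sigma> in auto)
      have "(1 + 1 / \<sigma>) * t powr \<sigma> = t powr \<sigma> + t powr \<sigma> / \<sigma>" by (simp add: algebra_simps)
      then have "t powr \<sigma> + - \<eta> * t powr n \<le> - ln t" using elim(1) l by linarith
      then have "exp (t powr \<sigma> + - \<eta> * t powr n) \<le> exp (- ln t)" by simp
      also have "exp (- ln t) = 1 / t" using elim by (simp add: exp_minus divide_inverse)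
      finally show "exp (t powr \<sigma>) * exp (- \<eta> * t powr n) \<le> 1 / t" by (simp only: exp_add)
    qed simp
    finally show ?case .
  qed
  then obtain C where "eventually (\<lambda>t. (norm (f (of_real t * cis \<theta>)))\<^sup>2 \<le> C * t ^ 2) at_top"
    using linear_growth_on_ray[OF f(1)] by blast
  then show ?thesis by (rule ray_growth_of_power_bound[OF f(2,3) s])
qed

lemma ray_growth_left:
  fixes f h1 h0 Q :: "complex \<Rightarrow> complex" and n :: nat
  assumes f: "f holomorphic_on UNIV" "exp_growth \<tau> f" "\<tau> > 0" and s: "s > 0"
    and h1: "eventually (\<lambda>t. norm (h1 (of_real t * cis \<theta>)) \<le> exp (t powr \<sigma>)) at_top"
    and h0: "eventually (\<lambda>t. norm (h0 (of_real t * cis \<theta>)) \<le> exp (t powr \<sigma>)) at_top"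
    and \<sigma>: "0 < \<sigma>" "\<sigma> < real n" and c: "c \<ge> 1" and \<delta>: "\<delta> > 0"
    and eq: "\<And>z. deriv (deriv f) z + h1 z * exp (of_real c * Q z + k) * deriv f z + h0 z * exp (Q z) * f z = 0"
    and Q: "eventually (\<lambda>t. Re (Q (of_real t * cis \<theta>)) \<le> - \<delta> * t ^ n) at_top"
  shows "ray_growth s f \<theta>"
proof -
  have "eventually (\<lambda>t. \<bar>Re k\<bar> + (1 + 2 / \<sigma>) * t powr \<sigma> \<le> \<delta> * t powr n) at_top"
    by (rule eventually_powr_dominated) (use \<sigma> \<delta> in auto)
  then have "eventually (\<lambda>t. norm (deriv (deriv f) (of_real t * cis \<theta>)) \<le>
        1 / t * norm (deriv f (of_real t * cis \<theta>)) + 1 / t\<^sup>2 * norm (f (of_real t * cis \<theta>))) at_top"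
    using h1 h0 Q eventually_ge_at_top[of 1]
  proof eventually_elim
    case (elim t)
    let ?z = "of_real t * cis \<theta>"
    define q where "q = Re (Q ?z)"
    have tn: "t powr n = t ^ n" using elim by (simp add: powr_realpow)
    have l: "ln t \<le> t powr \<sigma> / \<sigma>" by (rule ln_powr_bound) (use elim \<sigma> in auto)
    have sp: "(1 + 2 / \<sigma>) * t powr \<sigma> = t powr \<sigma> + 2 * (t powr \<sigma> / \<sigma>)" by (simp add: algebra_simps)
    have q: "q \<le> - (\<delta> * t powr n)" using elim by (simp add: q_def tn)
    have "\<delta> * t powr n \<ge> 0" using \<delta> by simp
    \<comment> \<open>As q <= 0, the factor c >= 1 gives exp(c q) <= exp q, so one smallness
      estimate covers both coefficients.\<close>
    then have "c * q \<le> 1 * q" using q c by (intro mult_right_mono_neg) linarith+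
    have small: "exp (t powr \<sigma> + \<bar>Re k\<bar> + q) \<le> 1 / t\<^sup>2"
    proof -
      have "t powr \<sigma> + \<bar>Re k\<bar> + q \<le> - (2 * ln t)" using elim(1) l q unfolding sp by linarith
      then have "exp (t powr \<sigma> + \<bar>Re k\<bar> + q) \<le> exp (- (2 * ln t))" by simp
      also have "\<dots> = 1 / t\<^sup>2" using elim exp_of_nat_mult[of 2 "ln t"] by (simp add: exp_minus divide_inverse)
      finally show ?thesis .
    qed
    have "norm (h1 ?z * exp (of_real c * Q ?z + k)) = norm (h1 ?z) * exp (c * q + Re k)"
      by (simp add: norm_mult q_def)
    also have "\<dots> \<le> exp (t powr \<sigma>) * exp (c * q + Re k)" using elim by (intro mult_right_mono) auto
    also have "\<dots> = exp (t powr \<sigma> + (c * q + Re k))" by (simp only: exp_add)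
    also have "\<dots> \<le> exp (t powr \<sigma> + \<bar>Re k\<bar> + q)" using \<open>c * q \<le> 1 * q\<close> unfolding exp_le_cancel_iff by linarith
    also have "\<dots> \<le> 1 / t\<^sup>2" by (rule small)
    also have "\<dots> \<le> 1 / t" using elim by (intro divide_left_mono) (auto simp: power2_eq_square)
    finally have A: "norm (h1 ?z * exp (of_real c * Q ?z + k)) \<le> 1 / t" .
    have "norm (h0 ?z * exp (Q ?z)) = norm (h0 ?z) * exp q" by (simp add: norm_mult q_def)
    also have "\<dots> \<le> exp (t powr \<sigma>) * exp q" using elim by (intro mult_right_mono) auto
    also have "\<dots> = exp (t powr \<sigma> + q)" by (simp only: exp_add)
    also have "\<dots> \<le> exp (t powr \<sigma> + \<bar>Re k\<bar> + q)" by simp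
    also have "\<dots> \<le> 1 / t\<^sup>2" by (rule small)
    finally have B: "norm (h0 ?z * exp (Q ?z)) \<le> 1 / t\<^sup>2" .
    have "deriv (deriv f) ?z = - (h1 ?z * exp (of_real c * Q ?z + k) * deriv f ?z + h0 ?z * exp (Q ?z) * f ?z)"
      using eq[of ?z] by (simp add: add_eq_0_iff add.assoc)
    then have "norm (deriv (deriv f) ?z) \<le> norm (h1 ?z * exp (of_real c * Q ?z + k) * deriv f ?z) + norm (h0 ?z * exp (Q ?z) * f ?z)"
      by (metis norm_minus_cancel norm_triangle_ineq)
    also have "\<dots> = norm (h1 ?z * exp (of_real c * Q ?z + k)) * norm (deriv f ?z) + norm (h0 ?z * exp (Q ?z)) * norm (f ?z)"
      by (simp only: norm_mult)
    also have "\<dots> \<le> 1 / t * norm (deriv f ?z) + 1 / t\<^sup>2 * norm (f ?z)"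
      using A B by (intro add_mono mult_right_mono) auto
    finally show ?case .
  qed
  then obtain C where "eventually (\<lambda>t. (norm (f (of_real t * cis \<theta>)))\<^sup>2 \<le> C * t ^ 6) at_top"
    using cubic_growth_on_ray[OF f(1)] by blast
  then show ?thesis by (rule ray_growth_of_power_bound[OF f(2,3) s])
qed

section \<open>Choice of exponents and rays, and the cases \<open>c = 1\<close> and
  \<open>c > 1\<close>\<close>

theorem theorem4:
  fixes P1 P0 :: "complex poly" and h1 h0 f :: "complex \<Rightarrow> complex" and n :: nat and c :: real
  assumes "n \<ge> 1"
    and "degree P1 = n" and "degree P0 = n"
    and "h1 holomorphic_on UNIV" and "h0 holomorphic_on UNIV"
    and "\<exists>z. h1 z \<noteq> 0" and "\<exists>z. h0 z \<noteq> 0"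
    and "ent_order h1 < ereal (real (degree P1))"
    and "ent_order h0 < ereal (real (degree P0))"
    and "c \<ge> 1" and "degree (P1 - smult (complex_of_real c) P0) = 0"
    and "fabry_gaps h1"
    and "ent_lower_order h0 > ent_order h1"
    and "f holomorphic_on UNIV"
    and "\<forall>z. deriv (deriv f) z + h1 z * exp (poly P1 z) * deriv f z
              + h0 z * exp (poly P0 z) * f z = 0"
    and "\<not> (\<exists>a. \<forall>z. f z = a)"
  shows "ent_order f = \<infinity>"
proof (rule ccontr)
  assume "ent_order f \<noteq> \<infinity>"
  then obtain m :: nat where m: "ent_order f < ereal (real m)" using less_PInf_Ex_of_nat by auto
  define \<tau> where "\<tau> = real m + 1"
  have "ereal (real m) < ereal \<tau>" by (simp add: \<tau>_def)
  with m have "ent_order f < ereal \<tau>" by (rule less_trans)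
  moreover have \<tau>: "\<tau> > 0" by (simp add: \<tau>_def)
  ultimately have fg: "exp_growth \<tau> f" by (intro exp_growth_of_ent_order assms)
  note f = assms(14) and h1 = assms(4) and h0 = assms(5) and n1 = assms(1) and n0 = assms(3)

  \<comment> \<open>Lower order never exceeds order, so the hypothesis on the lower order of
    \<open>h0\<close> separates the orders of \<open>h1\<close> and \<open>h0\<close>.\<close>
  have "ent_lower_order h0 \<le> ent_order h0"
    unfolding ent_lower_order_def ent_order_def by (rule Liminf_le_Limsup) simp
  with assms(13) have ord: "ent_order h1 < ent_order h0" by simp
  \<comment> \<open>Two numbers are placed in the gap: \<open>s1\<close> for the growth of
    \<open>h1\<close>, and \<open>s2\<close> as room for the constant when growth of
    \<open>h0\<close> with exponent \<open>s1\<close> is turned back into a bound for its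
    order.\<close>
  obtain s1 where s1: "ent_order h1 < ereal s1" "ereal s1 < ent_order h0" using ereal_dense2[OF ord] by blast
  obtain s2 where s2: "ereal s1 < ereal s2" "ereal s2 < ent_order h0" using ereal_dense2[OF s1(2)] by blast
  obtain s0 where s0: "ent_order h0 < ereal s0" "ereal s0 < ereal (real n)"
    using ereal_dense2[OF assms(9)] n0 by auto
  have "0 < ereal s1" using ent_order_nonneg[of h1] s1(1) by (rule le_less_trans)
  moreover have "ereal s2 < ereal s0" using s2(2) s0(1) by (rule less_trans)
  ultimately have s: "0 < s1" "s1 < s2" "s2 < s0" "s0 < real n" using s2 s0 by auto
  have h1g: "exp_growth s1 h1" by (rule exp_growth_of_ent_order[OF h1 s1(1) s(1)])
  have h0g: "exp_growth s0 h0" by (rule exp_growth_of_ent_order[OF h0 s0(1)]) (use s in simp)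

  obtain k where k: "P1 - smult (complex_of_real c) P0 = [:k:]"
    using assms(11) by (rule degree_eq_zeroE)
  define Q where "Q = poly P0"
  have P1: "poly P1 z = of_real c * Q z + k" for z
    using arg_cong[OF k, of "\<lambda>p. poly p z"] by (simp add: Q_def algebra_simps)
  have eq: "deriv (deriv f) z + h1 z * exp (of_real c * Q z + k) * deriv f z + h0 z * exp (Q z) * f z = 0" for z
    using assms(15) unfolding P1 Q_def by blast

  \<comment> \<open>The zeros of f' can be avoided because f' is not identically zero; this rests on
    \<open>f\<close> being non-constant.\<close>
  have dnz: "\<exists>z. deriv f z \<noteq> 0"
  proof (rule ccontr)
    assume "\<not> ?thesis"
    then have "(f has_field_derivative 0) (at z)" for z
      using holomorphic_derivI[OF f open_UNIV, of z] by simp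
    then have "\<exists>a. \<forall>z\<in>UNIV. f z = a" by (intro has_field_derivative_zero_constant) auto
    then show False using assms(16) by blast
  qed
  have fnz: "\<exists>z. f z \<noteq> 0" using assms(16) by blast
  have f': "deriv f holomorphic_on UNIV" using f by (simp add: holomorphic_deriv)
  define Z where "Z = {a. f a = 0} \<union> {a. deriv f a = 0} \<union> {a. h1 a = 0}"
  have "poly_count Z" unfolding Z_def
    by (intro poly_count_Un poly_count_zeros[OF f fnz \<tau> fg]
         poly_count_zeros[OF f' dnz \<tau> exp_growth_deriv[OF f fg \<tau>]] poly_count_zeros[OF h1 assms(6) s(1) h1g])
  then obtain N where dense: "\<And>x y. x < y \<Longrightarrow> \<exists>\<theta>. x < \<theta> \<and> \<theta> < y \<and> avoids Z N \<theta>"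
    using avoids_dense by blast

  define b where "b = norm (lead_coeff P0)"
  define \<phi> where "\<phi> = Arg (lead_coeff P0)"
  have lc: "lead_coeff P0 = of_real b * cis \<phi>"
    using rcis_cmod_Arg[of "lead_coeff P0"] by (simp add: b_def \<phi>_def rcis_def)
  have b: "b > 0" using n0 n1 by (auto simp: b_def)
  define g where "g \<theta> = cos (\<phi> + real n * \<theta>)" for \<theta>
  have gc: "isCont g \<theta>" for \<theta> unfolding g_def by (intro continuous_intros)
  have gpos: "\<exists>\<delta>>0. eventually (\<lambda>t. \<delta> * t ^ n \<le> Re (Q (of_real t * cis \<theta>))) at_top" if "g \<theta> > 0" for \<theta>
    using poly_ray_Re(1)[OF lc b, of \<theta>] that n0 by (simp add: g_def Q_def)
  have gneg: "\<exists>\<delta>>0. eventually (\<lambda>t. Re (Q (of_real t * cis \<theta>)) \<le> - \<delta> * t ^ n) at_top" if "g \<theta> < 0" for \<theta>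
    using poly_ray_Re(2)[OF lc b, of \<theta>] that n0 by (simp add: g_def Q_def)
  \<comment> \<open>In terms of the phase \<phi> + n \<theta>, the gaps of length pi between
    positive directions become gaps of opening pi / n.\<close>
  have pos_dir: "\<exists>x1 x2. x1 < \<theta> \<and> \<theta> < x2 \<and> x2 - x1 < (pi + e) / real n \<and> g x1 > 0 \<and> g x2 > 0" if "e > 0" for e \<theta>
  proof -
    obtain u v where uv: "u < \<phi> + real n * \<theta>" "\<phi> + real n * \<theta> < v" "v - u < pi + e" "cos u > 0" "cos v > 0"
      using cos_pos_both_sides[OF \<open>e > 0\<close>] by blast
    have np: "real n > 0" using n1 by simp
    have "(v - \<phi>) / real n - (u - \<phi>) / real n = (v - u) / real n" by (simp add: diff_divide_distrib)
    also have "\<dots> < (pi + e) / real n" using uv(3) np by (rule divide_strict_right_mono)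
    finally have "(v - \<phi>) / real n - (u - \<phi>) / real n < (pi + e) / real n" .
    moreover have "(u - \<phi>) / real n < \<theta>" "\<theta> < (v - \<phi>) / real n"
      using uv np by (simp_all add: pos_divide_less_eq pos_less_divide_eq mult.commute)
    moreover have "g ((u - \<phi>) / real n) > 0" "g ((v - \<phi>) / real n) > 0"
      using uv np by (simp_all add: g_def)
    ultimately show ?thesis by blast
  qed
  have ld: "\<exists>p. eventually (\<lambda>t. f (of_real t * cis \<theta>) \<noteq> 0 \<and>
      norm (deriv f (of_real t * cis \<theta>)) \<le> t ^ p * norm (f (of_real t * cis \<theta>)) \<and>
      norm (deriv (deriv f) (of_real t * cis \<theta>)) \<le> t ^ p * norm (f (of_real t * cis \<theta>))) at_top"
    if "avoids Z N \<theta>" for \<theta>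
    by (rule logarithmic_derivatives_on_ray[OF f dnz \<tau> fg that]) (auto simp: Z_def)

  show False
  proof (cases "c = 1")
    case True
    have ray: "ray_growth s1 h0 \<theta>" if av: "avoids Z N \<theta>" and g: "g \<theta> > 0" for \<theta>
    proof -
      obtain p where p: "eventually (\<lambda>t. f (of_real t * cis \<theta>) \<noteq> 0 \<and>
        norm (deriv f (of_real t * cis \<theta>)) \<le> t ^ p * norm (f (of_real t * cis \<theta>)) \<and>
        norm (deriv (deriv f) (of_real t * cis \<theta>)) \<le> t ^ p * norm (f (of_real t * cis \<theta>))) at_top"
        using ld[OF av] by blast
      obtain \<delta> where \<delta>: "\<delta> > 0" "eventually (\<lambda>t. \<delta> * t ^ n \<le> Re (Q (of_real t * cis \<theta>))) at_top"
        using gpos[OF g] by blast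
      have Q0: "eventually (\<lambda>t. 0 \<le> Re (Q (of_real t * cis \<theta>))) at_top"
        using \<delta>(2) eventually_ge_at_top[of 0]
      proof eventually_elim
        case (elim t)
        have "0 \<le> \<delta> * t ^ n" using \<delta>(1) elim by simp
        then show ?case using elim by linarith
      qed
      have eq1: "deriv (deriv f) z + h1 z * exp (Q z + k) * deriv f z + h0 z * exp (Q z) * f z = 0" for z
        using eq[of z] True by simp
      show ?thesis
        by (rule coefficient_growth_equal_exponents[OF h1g s(1) h0g _ eq1 Q0 p]) (use s in simp)
    qed
    \<comment> \<open>\<kappa> exceeds the growth exponent \<open>s0\<close>, as Phragmen-Lindelof
      requires, and stays below n, so that pi/\<kappa> is larger than the gap pi/n that has to be
      bridged.\<close>
    define \<kappa> where "\<kappa> = (s0 + real n) / 2"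
    have \<kappa>: "s0 < \<kappa>" "\<kappa> < real n" "\<kappa> > 0" using s by (auto simp: \<kappa>_def)
    \<comment> \<open>Solves \<kappa> (pi + e) / n = pi; it is positive because \<kappa> <
      n.\<close>
    define e where "e = pi * (real n / \<kappa> - 1)"
    have e: "e > 0" "\<kappa> * ((pi + e) / real n) = pi" using \<kappa> n1 by (auto simp: e_def field_simps)
    have "exp_growth s1 h0"
    proof (rule exp_growth_from_rays[OF h0 h0g _ \<kappa>(1) s(1)])
      fix \<theta>
      obtain x1 x2 where x: "x1 < \<theta>" "\<theta> < x2" "x2 - x1 < (pi + e) / real n" "g x1 > 0" "g x2 > 0"
        using pos_dir[OF e(1)] by blast
      \<comment> \<open>The spare opening, split evenly between the two ends when \<open>x1\<close>
        and \<open>x2\<close> are moved to nearby zero-avoiding rays.\<close>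
      define d where "d = (pi + e) / real n - (x2 - x1)"
      have d: "d > 0" using x by (simp add: d_def)
      have "g x1 \<noteq> 0" "x1 - d / 2 < x1" using x d by auto
      then obtain \<theta>1 where \<theta>1: "x1 - d / 2 < \<theta>1" "\<theta>1 < \<theta>" "avoids Z N \<theta>1" "sgn (g \<theta>1) = sgn (g x1)"
        using dense_in_open_sign[OF gc dense] x(1) by metis
      have "g x2 \<noteq> 0" "x2 < x2 + d / 2" using x d by auto
      then obtain \<theta>2 where \<theta>2: "\<theta> < \<theta>2" "\<theta>2 < x2 + d / 2" "avoids Z N \<theta>2" "sgn (g \<theta>2) = sgn (g x2)"
        using dense_in_open_sign[OF gc dense] x(2) by metis
      have "g \<theta>1 > 0" "g \<theta>2 > 0" using \<theta>1(4) \<theta>2(4) x(4,5) by (simp_all add: sgn_1_pos)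
      then have "ray_growth s1 h0 \<theta>1" "ray_growth s1 h0 \<theta>2" using ray \<theta>1 \<theta>2 by auto
      moreover have "\<kappa> * (\<theta>2 - \<theta>1) < pi"
      proof -
        have "\<theta>2 - \<theta>1 < (pi + e) / real n" using \<theta>1(1) \<theta>2(2) unfolding d_def by argo
        then have "\<kappa> * (\<theta>2 - \<theta>1) < \<kappa> * ((pi + e) / real n)" using \<kappa>(3) by (rule mult_strict_left_mono)
        then show ?thesis using e(2) by simp
      qed
      ultimately show "\<exists>\<theta>1 \<theta>2. \<theta>1 < \<theta> \<and> \<theta> < \<theta>2 \<and> \<kappa> * (\<theta>2 - \<theta>1) < pi \<and> ray_growth s1 h0 \<theta>1 \<and> ray_growth s1 h0 \<theta>2"
        using \<theta>1 \<theta>2 by blast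
    qed (use s \<kappa> in auto)
    then have "ent_order h0 \<le> ereal s2" by (rule ent_order_le_of_exp_growth) (use s in auto)
    then show False using s2(2) by simp
  next
    case False
    then have c: "c > 1" using assms(10) by simp
    \<comment> \<open>One exponent below n for everything: above \<open>s0\<close>, hence above
      \<open>s1\<close>, and above 3/4, which keeps it clear of the order 1/2 to be obtained for
      \<open>f\<close>. The choice is possible since 3/4 < 1 <= n.\<close>
    define \<sigma> where "\<sigma> = (max s0 (3/4) + real n) / 2"
    have "real n \<ge> 1" using n1 by simp
    then have "3/4 < real n" by linarith
    with s have "max s0 (3/4) < real n" by simp
    then have "max s0 (3/4) < \<sigma>" "\<sigma> < real n" by (auto simp: \<sigma>_def)
    then have \<sigma>: "s0 < \<sigma>" "s1 < \<sigma>" "3/4 < \<sigma>" "\<sigma> < real n" "\<sigma> > 0"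
      using s by auto
    have h0u: "eventually (\<lambda>t. norm (h0 (of_real t * cis \<theta>)) \<le> exp (t powr \<sigma>)) at_top" for \<theta>
      by (rule exp_growth_ray[OF h0g]) (use s \<sigma> in auto)
    have h1u: "eventually (\<lambda>t. norm (h1 (of_real t * cis \<theta>)) \<le> exp (t powr \<sigma>)) at_top" for \<theta>
      by (rule exp_growth_ray[OF h1g]) (use s \<sigma> in auto)
    have h1l: "eventually (\<lambda>t. exp (- (t powr \<sigma>)) \<le> norm (h1 (of_real t * cis \<theta>))) at_top" if "avoids Z N \<theta>" for \<theta>
      by (rule ray_estimates(2)[OF h1 assms(6) s(1) h1g that]) (use \<sigma> in \<open>auto simp: Z_def\<close>)
    have dec: "\<exists>\<eta>>0. eventually (\<lambda>t. norm (h1 (of_real t * cis \<theta>)) * norm (deriv f (of_real t * cis \<theta>))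
        \<le> exp (- \<eta> * t powr n) * norm (f (of_real t * cis \<theta>))) at_top" if av: "avoids Z N \<theta>" and g: "g \<theta> > 0" for \<theta>
    proof -
      obtain p where p: "eventually (\<lambda>t. f (of_real t * cis \<theta>) \<noteq> 0 \<and>
        norm (deriv f (of_real t * cis \<theta>)) \<le> t ^ p * norm (f (of_real t * cis \<theta>)) \<and>
        norm (deriv (deriv f) (of_real t * cis \<theta>)) \<le> t ^ p * norm (f (of_real t * cis \<theta>))) at_top"
        using ld[OF av] by blast
      obtain \<delta> where \<delta>: "\<delta> > 0" "eventually (\<lambda>t. \<delta> * t ^ n \<le> Re (Q (of_real t * cis \<theta>))) at_top"
        using gpos[OF g] by blast
      show ?thesis
        by (rule exponential_decay_on_ray[OF h0u \<sigma>(5,4) c \<delta>(1) eq \<delta>(2) p]) blast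
    qed
    have ray: "ray_growth (1/2) f \<theta>" if av: "avoids Z N \<theta>" and g: "g \<theta> \<noteq> 0" for \<theta>
    proof (cases "g \<theta> > 0")
      case True
      obtain \<eta> where \<eta>: "\<eta> > 0" "eventually (\<lambda>t. norm (h1 (of_real t * cis \<theta>)) * norm (deriv f (of_real t * cis \<theta>))
        \<le> exp (- \<eta> * t powr n) * norm (f (of_real t * cis \<theta>))) at_top"
        using dec[OF av True] by blast
      show ?thesis by (rule ray_growth_right[OF f fg \<tau> _ h1l[OF av] \<sigma>(5,4) \<eta>]) simp
    next
      case False
      then have "g \<theta> < 0" using g by simp
      then obtain \<delta> where \<delta>: "\<delta> > 0" "eventually (\<lambda>t. Re (Q (of_real t * cis \<theta>)) \<le> - \<delta> * t ^ n) at_top"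
        using gneg by blast
      show ?thesis by (rule ray_growth_left[OF f fg \<tau> _ h1u h0u \<sigma>(5,4) assms(10) \<delta>(1) eq \<delta>(2)]) simp
    qed
    define \<kappa> where "\<kappa> = \<tau> + 1"
    have "exp_growth (1/2) f"
    proof (rule exp_growth_from_rays[OF f fg \<tau>, where \<kappa> = \<kappa>])
      fix \<theta>
      \<comment> \<open>Each side of \<theta> gets 1/\<kappa>, so the total opening stays below
        2/\<kappa> < pi/\<kappa> however large \<tau> is.\<close>
      define d where "d = 1 / \<kappa>"
      have d: "d > 0" "\<kappa> * d = 1" using \<tau> by (auto simp: d_def \<kappa>_def)
      have n0': "real n > 0" using n1 by simp
      have "\<theta> - d < \<theta>" using d by simp
      then obtain x1 where x1: "\<theta> - d < x1" "x1 < \<theta>" "g x1 \<noteq> 0"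
        using cos_affine_nonzero_dense[OF _ n0', of "\<theta> - d" \<theta> \<phi>] unfolding g_def by blast
      obtain \<theta>1 where \<theta>1: "\<theta> - d < \<theta>1" "\<theta>1 < \<theta>" "avoids Z N \<theta>1" "sgn (g \<theta>1) = sgn (g x1)"
        using dense_in_open_sign[OF gc dense x1(3,1,2)] by blast
      have "\<theta> < \<theta> + d" using d by simp
      then obtain x2 where x2: "\<theta> < x2" "x2 < \<theta> + d" "g x2 \<noteq> 0"
        using cos_affine_nonzero_dense[OF _ n0', of \<theta> "\<theta> + d" \<phi>] unfolding g_def by blast
      obtain \<theta>2 where \<theta>2: "\<theta> < \<theta>2" "\<theta>2 < \<theta> + d" "avoids Z N \<theta>2" "sgn (g \<theta>2) = sgn (g x2)"
        using dense_in_open_sign[OF gc dense x2(3,1,2)] by blast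
      have "g \<theta>1 \<noteq> 0" "g \<theta>2 \<noteq> 0" using \<theta>1(4) \<theta>2(4) x1 x2 by (metis sgn_0_0)+
      then have "ray_growth (1/2) f \<theta>1" "ray_growth (1/2) f \<theta>2" using ray \<theta>1 \<theta>2 by auto
      moreover have "\<kappa> * (\<theta>2 - \<theta>1) < pi"
      proof -
        have "\<kappa> * (\<theta>2 - \<theta>1) \<le> \<kappa> * (2 * d)" using \<theta>1 \<theta>2 \<tau> by (intro mult_left_mono) (auto simp: \<kappa>_def)
        also have "\<dots> = 2" using d(2) by simp
        also have "\<dots> < pi" using pi_gt3 by simp
        finally show ?thesis .
      qed
      ultimately show "\<exists>\<theta>1 \<theta>2. \<theta>1 < \<theta> \<and> \<theta> < \<theta>2 \<and> \<kappa> * (\<theta>2 - \<theta>1) < pi \<and> ray_growth (1/2) f \<theta>1 \<and> ray_growth (1/2) f \<theta>2"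
        using \<theta>1 \<theta>2 by blast
    qed (use \<tau> in \<open>auto simp: \<kappa>_def\<close>)
    then have fg2: "exp_growth (1/2) f" "exp_growth (1/2) (deriv f)" by (auto intro: exp_growth_deriv[OF f])
    \<comment> \<open>A single direction of exponential decay is enough for the contradiction, so
      the starting angle 0 and the slack 1 are arbitrary.\<close>
    obtain x where "g x > 0" using pos_dir[of 1 0] by auto
    then obtain \<theta> where \<theta>: "avoids Z N \<theta>" "g \<theta> > 0"
      using dense_in_open_sign[OF gc dense, of x "x - 1" "x + 1"] by (force simp: sgn_1_pos)
    obtain \<eta> where \<eta>: "\<eta> > 0" "eventually (\<lambda>t. norm (h1 (of_real t * cis \<theta>)) * norm (deriv f (of_real t * cis \<theta>))
        \<le> exp (- \<eta> * t powr n) * norm (f (of_real t * cis \<theta>))) at_top"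
      using dec[OF \<theta>] by blast
    have fu: "eventually (\<lambda>t. norm (f (of_real t * cis \<theta>)) \<le> exp (t powr \<sigma>)) at_top"
      by (rule exp_growth_ray[OF fg2(1)]) (use \<sigma> in auto)
    have fl: "eventually (\<lambda>t. exp (- (t powr \<sigma>)) \<le> norm (deriv f (of_real t * cis \<theta>))) at_top"
      by (rule ray_estimates(2)[OF f' dnz _ fg2(2) \<theta>(1)]) (use \<sigma> in \<open>auto simp: Z_def\<close>)
    \<comment> \<open>Three powers t^\<sigma>: two from the lower bounds for \<open>h1\<close> and
      \<open>deriv f\<close>, one from the upper bound for \<open>f\<close>. The 1 makes the
      contradiction strict.\<close>
    have dom: "eventually (\<lambda>t. 1 + 3 * t powr \<sigma> \<le> \<eta> * t powr n) at_top"
      by (rule eventually_powr_dominated) (use \<sigma> \<eta> in auto)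
    have "eventually (\<lambda>t::real. False) at_top"
      using \<eta>(2) fu fl h1l[OF \<theta>(1)] dom
    proof eventually_elim
      case (elim t)
      let ?z = "of_real t * cis \<theta>"
      have "exp (- (t powr \<sigma>)) * exp (- (t powr \<sigma>)) \<le> norm (h1 ?z) * norm (deriv f ?z)"
        using elim by (intro mult_mono) auto
      also have "\<dots> \<le> exp (- \<eta> * t powr n) * norm (f ?z)" using elim by blast
      also have "\<dots> \<le> exp (- \<eta> * t powr n) * exp (t powr \<sigma>)" using elim by (intro mult_left_mono) auto
      finally have "exp (- (t powr \<sigma>) + - (t powr \<sigma>)) \<le> exp (- \<eta> * t powr n + t powr \<sigma>)" by (simp only: exp_add)
      then show False using elim(5) by simp
    qed
    then show False by simp
  qed
qed

end
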